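(* Let $\eta_t$ be the random configuration of the TASEP at time $t>0$ started from the step configuration, let $N_t^0:=\eta_t(0)+\eta_t(1)+\eta_t(2)+\cdots$, and let $G:\mathbb{Z}_{\ge 0}\to\mathbb{R}$ be a function. Then $$\frac{\partial}{\partial t}\,\mathbb{E}\,G(N_t^0)=-\frac1t\,\mathbb{E}\left(N_t^0\bigl(G(N_t^0-1)-G(N_t^0)\bigr)\sum_{x=1}^\infty x\,\eta_t(-x-1)\prod_{k=1}^x[1-\eta_t(-k)]\right).$$ In the sum over $x$ in the right-hand side almost surely only one term is nonzero, and the whole sum is equal to the distance of the rightmost particle in $\mathbb{Z}_{<0}$ to zero.
   Context: The TASEP is the continuous-time Markov process on particle configurations on $\mathbb{Z}$ (at most one particle per site) in which each particle, independently at rate $1$, attempts to jump to the right by one; the jump happens if the destination is empty, and otherwise nothing happens. $\eta_t(x)\in\{0,1\}$ is the occupation variable: $\eta_t(x)=1$ if there is a particle at site $x$ at time $t$, and $\eta_t(x)=0$ otherwise. The step configuration is $\eta_0(x)=1$ if and only if $x<0$. Thus $N_t^0$ is the number of particles at sites $x\ge 0$ at time $t$.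
   Formalization: G(N_s^0) is assumed integrable for s near t, as E G(N_t^0) may not exist for arbitrary G; at most one term is nonzero, and the sum equals the number of sites strictly between the rightmost negative particle and 0 (its distance minus one: a particle at -1 gives sum 0). *)

theory Defs
  imports "HOL-Probability.Probability"
begin

(* The clock of particle i rings at the partial sums of its waiting times W i 0, W i 1, ...;
   for i.i.d. Exp(1) waiting times this is a Poisson process of rate 1. *)
definition ring_time :: "('i \<Rightarrow> nat \<Rightarrow> 'w \<Rightarrow> real) \<Rightarrow> 'i \<Rightarrow> nat \<Rightarrow> 'w \<Rightarrow> real" where
  "ring_time W i n \<omega> = (\<Sum>m\<le>n. W i m \<omega>)"

(* Position just before time s.  Int carries the discrete topology, so on a piecewise constant
   path this is the value taken on some interval (s - e, s). *)
definition pos_before :: "('i \<Rightarrow> real \<Rightarrow> int) \<Rightarrow> 'i \<Rightarrow> real \<Rightarrow> int" where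
  "pos_before \<xi> i s = Lim (at_left s) (\<xi> i)"

(* \<xi> is a trajectory of labelled particles on \<int> started from \<xi>0, where R i is the set of times at
   which particle i attempts to jump: at such a time it moves one step to the right if no
   particle sits there just before, and it does not move at any other time. *)
definition tasep_path ::
    "('i \<Rightarrow> real set) \<Rightarrow> ('i \<Rightarrow> int) \<Rightarrow> ('i \<Rightarrow> real \<Rightarrow> int) \<Rightarrow> bool" where
  "tasep_path R \<xi>0 \<xi> \<longleftrightarrow>
     (\<forall>i. \<xi> i 0 = \<xi>0 i) \<and>
     (\<forall>i. \<forall>s\<in>R i. \<xi> i s =
        (if \<exists>j. pos_before \<xi> j s = pos_before \<xi> i s + 1
         then pos_before \<xi> i s else pos_before \<xi> i s + 1)) \<and>
     (\<forall>i a b. 0 \<le> a \<and> a \<le> b \<and> R i \<inter> {a<..b} = {} \<longrightarrow> \<xi> i b = \<xi> i a)"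

(* X i t is the position at time t of the particle labelled i. *)
locale tasep = prob_space M
  for M :: "'w measure"
    and \<xi>0 :: "'i::countable \<Rightarrow> int"
    and W :: "'i \<Rightarrow> nat \<Rightarrow> 'w \<Rightarrow> real"
    and X :: "'i \<Rightarrow> real \<Rightarrow> 'w \<Rightarrow> int" +
  assumes inj_init: "inj \<xi>0"
    and indep_waiting: "indep_vars (\<lambda>_. borel) (\<lambda>(i, n). W i n) (UNIV :: ('i \<times> nat) set)"
    and exp_waiting: "\<And>i n. distributed M lborel (W i n) (exponential_density 1)"
    and measurable_pos: "\<And>i t. 0 \<le> t \<Longrightarrow> X i t \<in> measurable M (count_space UNIV)"
    and path: "AE \<omega> in M. tasep_path (\<lambda>i. range (\<lambda>n. ring_time W i n \<omega>)) \<xi>0 (\<lambda>i t. X i t \<omega>)"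

definition occupation :: "('i \<Rightarrow> real \<Rightarrow> 'w \<Rightarrow> int) \<Rightarrow> real \<Rightarrow> int \<Rightarrow> 'w \<Rightarrow> nat" where
  "occupation X t x \<omega> = (if \<exists>i. X i t \<omega> = x then 1 else 0)"

definition step_init :: "nat \<Rightarrow> int" where
  "step_init i = - 1 - int i"

lemma occupation_step_init:
  assumes "tasep M step_init W X"
  shows "AE \<omega> in M. \<forall>x. occupation X 0 x \<omega> = (if x < 0 then 1 else 0)"
proof -
  have *: "(\<exists>i. - 1 - int i = x) \<longleftrightarrow> x < 0" for x :: int
  proof
    assume "x < 0"
    then have "- 1 - int (nat (- 1 - x)) = x" by simp
    then show "\<exists>i. - 1 - int i = x" ..
  qed auto
  show ?thesis
    using tasep.path[OF assms]
    by eventually_elim (simp add: tasep_path_def occupation_def step_init_def *)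
qed

(* The number of particles at sites x \<ge> 0 (almost surely finite from the step configuration). *)
definition N0 :: "('i \<Rightarrow> real \<Rightarrow> 'w \<Rightarrow> int) \<Rightarrow> real \<Rightarrow> 'w \<Rightarrow> nat" where
  "N0 X t \<omega> = (\<Sum>\<^sub>\<infinity>x\<in>{0..}. occupation X t x \<omega>)"

definition gap_term :: "('i \<Rightarrow> real \<Rightarrow> 'w \<Rightarrow> int) \<Rightarrow> real \<Rightarrow> nat \<Rightarrow> 'w \<Rightarrow> real" where
  "gap_term X t x \<omega> =
     real x * real (occupation X t (- int x - 1) \<omega>) *
     (\<Prod>k=1..x. 1 - real (occupation X t (- int k) \<omega>))"

definition gap_sum :: "('i \<Rightarrow> real \<Rightarrow> 'w \<Rightarrow> int) \<Rightarrow> real \<Rightarrow> 'w \<Rightarrow> real" where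
  "gap_sum X t \<omega> = (\<Sum>\<^sub>\<infinity>x\<in>{1..}. gap_term X t x \<omega>)"

(* In rhs_integrand the value G (N - 1) at N = 0 is multiplied by 0, so truncated subtraction
   is harmless. *)
definition rhs_integrand ::
    "(nat \<Rightarrow> real) \<Rightarrow> ('i \<Rightarrow> real \<Rightarrow> 'w \<Rightarrow> int) \<Rightarrow> real \<Rightarrow> 'w \<Rightarrow> real" where
  "rhs_integrand G X t \<omega> =
     real (N0 X t \<omega>) * (G (N0 X t \<omega> - 1) - G (N0 X t \<omega>)) * gap_sum X t \<omega>"

end

(* Label the particles 0, 1, 2, ... from right to left and let A be the TASEP generator. The backward
   dynamics B moves particle k to each empty site between particles k + 1 and k at rate k + 1. On
   functions of finitely many particles B A - A B = A, and B does nothing to the step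
   configuration, so E[B f] = - t E[A f] at time t when started from the step configuration. For f
   the indicator that particle n is at a site >= 0, A f indicates that particle n sits at -1 and may
   jump, and - B f is n + 1 times the size of the gap to the left of the origin on the event N = n + 1.
   Since d/dt E[f] = E[A f], this is the theorem for G an indicator of [n + 1, oo).

   The semigroup exp (t A) is read off the clocks: the labels of the rings up to time t of the first
   n particles form any given word of length m with probability exp (- n t) t^m / m!.

   A general G is a series of indicators. Since P(N_s = n) <= exp (T - s) P(N_T = n), and the
   flux from n to n + 1 at time s is at most a constant times P(N_T = n + 1) for s < T, integrability of
   G(N_T) for one T > t justifies termwise differentiation. *)

theory Submission
  imports Defs
begin

section \<open>The backward dynamics and the commutation relation\<close>

text \<open>A particle is blocked only by the one ahead, so particles \<open>0..n\<close> evolve on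
  their own under \<open>A\<close>. The dynamics \<open>B\<close> moves only particles below
  \<open>n\<close>; particle \<open>n\<close> merely closes the last gap, which is why the
  commutation relation is restricted to functions that ignore particle \<open>n\<close>. The rates
  \<open>k + 1\<close> come from a summation by parts: commuting \<open>A\<close> with the motion
  into gap \<open>k\<close> leaves the effect of a jump of \<open>k\<close> minus that of a jump of
  \<open>k + 1\<close>, and the weights \<open>k + 1\<close> add these differences up to
  \<open>A\<close>.

  Passing from the commutator to the identity at time \<open>t\<close> uses a Taylor expansion at
  time \<open>0\<close>, which needs bounds on \<open>B\<close> applied to all iterates of
  \<open>A\<close>. TASEP gaps are unbounded, whence the wall at \<open>b + 1\<close>. It does not
  disturb the observables: capping particle \<open>j\<close> at \<open>b - j\<close> yields exactly
  the walled process, and for \<open>b = k\<close>, \<open>n = k + 1\<close> the caps of particles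
  \<open>k - 1\<close>, \<open>k\<close>, \<open>k + 1\<close> are \<open>1\<close>,
  \<open>0\<close>, \<open>-1\<close>. So the caps do not change whether \<open>k\<close> has passed
  the origin, whether it sits at \<open>-1\<close> with a free target, or the size of the gap left
  of the origin once \<open>k\<close> has passed.\<close>

text \<open>Configurations list the particle positions from right to left. An immobile particle at site \<open>b + 1\<close>
  acts as a wall, which keeps the rate of the backward dynamics bounded.\<close>

definition ahead :: "int \<Rightarrow> (nat \<Rightarrow> int) \<Rightarrow> nat \<Rightarrow> int" where
  "ahead b y k = (case k of 0 \<Rightarrow> b + 1 | Suc j \<Rightarrow> y j)"

definition jump :: "int \<Rightarrow> nat \<Rightarrow> (nat \<Rightarrow> int) \<Rightarrow> (nat \<Rightarrow> int)" where
  "jump b k y = (if ahead b y k = y k + 1 then y else y(k := y k + 1))"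

definition fwd :: "int \<Rightarrow> nat \<Rightarrow> ((nat \<Rightarrow> int) \<Rightarrow> real) \<Rightarrow> (nat \<Rightarrow> int) \<Rightarrow> real" where
  "fwd b n f y = (\<Sum>k\<le>n. f (jump b k y) - f y)"

text \<open>The backward dynamics: each site between particles \<open>k + 1\<close> and \<open>k\<close> attracts particle \<open>k\<close> at rate
  \<open>k + 1\<close>, the number of particles to the right of that site.\<close>

definition pull :: "nat \<Rightarrow> ((nat \<Rightarrow> int) \<Rightarrow> real) \<Rightarrow> (nat \<Rightarrow> int) \<Rightarrow> real" where
  "pull k f y = (\<Sum>z\<in>{y (Suc k)<..<y k}. f (y(k := z)) - f y)"

text \<open>The sum stops below \<open>n\<close>, whereas \<open>fwd\<close> includes
  \<open>n\<close>: pulling particle \<open>n\<close> would require the position of particle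
  \<open>n + 1\<close>.\<close>

definition bwd :: "nat \<Rightarrow> ((nat \<Rightarrow> int) \<Rightarrow> real) \<Rightarrow> (nat \<Rightarrow> int) \<Rightarrow> real" where
  "bwd n f y = (\<Sum>k<n. real (Suc k) * pull k f y)"

definition ordered :: "int \<Rightarrow> nat \<Rightarrow> (nat \<Rightarrow> int) \<Rightarrow> bool" where
  "ordered b n y \<longleftrightarrow> (\<forall>k\<le>n. y k < ahead b y k)"

lemma ordered_Suc: "ordered b n y \<Longrightarrow> k < n \<Longrightarrow> y (Suc k) < y k"
  unfolding ordered_def ahead_def by (metis Suc_leI old.nat.simps(5))

lemma ordered_jump:
  assumes "ordered b n y"
  shows "ordered b n (jump b k y)"
  unfolding ordered_def
proof (intro allI impI)
  fix i assume i: "i \<le> n"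
  have 1: "y i < ahead b y i" using assms i by (auto simp: ordered_def)
  show "jump b k y i < ahead b (jump b k y) i"
    using 1 by (cases i) (auto simp: jump_def ahead_def)
qed

lemma sum_shift_open_int:
  fixes g :: "int \<Rightarrow> real"
  assumes "w < p"
  shows "(\<Sum>z\<in>{w<..<p}. g (z + 1)) = (\<Sum>z\<in>{w<..<p}. g z) + g p - g (w + 1)"
proof -
  have 1: "(\<Sum>z\<in>{w<..<p}. g (z + 1)) = (\<Sum>z\<in>{w+1<..<p+1}. g z)"
    by (rule sum.reindex_bij_witness[of _ "\<lambda>z. z - 1" "\<lambda>z. z + 1"]) auto
  have 2: "insert (w+1) {w+1<..<p+1} = insert p {w<..<p}" using assms by auto
  have "g (w+1) + (\<Sum>z\<in>{w+1<..<p+1}. g z) = (\<Sum>z\<in>insert (w+1) {w+1<..<p+1}. g z)"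
    by (subst sum.insert) auto
  also have "\<dots> = g p + (\<Sum>z\<in>{w<..<p}. g z)"
    unfolding 2 by (subst sum.insert) auto
  finally show ?thesis using 1 by simp
qed

lemma pull_alt: "pull k f y = (\<Sum>z\<in>{y (Suc k)<..<y k}. f (y(k := z))) - real (card {y (Suc k)<..<y k}) * f y"
  by (simp add: pull_def sum_subtractf)

text \<open>Among the jumps only that of \<open>Suc k\<close> reads the position of particle
  \<open>k\<close>, and only those of \<open>k\<close> and \<open>Suc k\<close> move an end of the
  gap.\<close>

lemma pull_jump_other:
  assumes "j \<noteq> k" "j \<noteq> Suc k"
  shows "(\<Sum>z\<in>{y (Suc k)<..<y k}. f (jump b j (y(k := z))) - f (jump b j y)) = pull k f (jump b j y)"
proof -
  have "jump b j (y(k := z)) = (jump b j y)(k := z)" for z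
    using assms by (cases j) (auto simp: jump_def ahead_def fun_eq_iff)
  moreover have "jump b j y k = y k" "jump b j y (Suc k) = y (Suc k)"
    using assms by (auto simp: jump_def)
  ultimately show ?thesis by (simp add: pull_def)
qed

text \<open>A pulled particle \<open>k\<close> is never blocked, so its jump shifts the target sites
  by one: the sum gains the site \<open>y k\<close> and loses the leftmost site. If
  \<open>y k\<close> is free to move, the gained site belongs to the enlarged gap; if it is blocked,
  \<open>jump b k y = y\<close>. Both cases give the same correction.\<close>

lemma pull_jump_self:
  assumes "y (Suc k) < y k" "y k < ahead b y k"
  shows "(\<Sum>z\<in>{y (Suc k)<..<y k}. f (jump b k (y(k := z))) - f (jump b k y))
         = pull k f (jump b k y) + f (jump b k y) - f (y(k := y (Suc k) + 1))"
proof -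
  have ah: "ahead b (y(k:=z)) k = ahead b y k" for z by (cases k) (auto simp: ahead_def)
  have "(\<Sum>z\<in>{y (Suc k)<..<y k}. f (jump b k (y(k := z)))) = (\<Sum>z\<in>{y (Suc k)<..<y k}. f (y(k := z + 1)))"
    using assms(2) by (intro sum.cong refl) (auto simp: jump_def ah)
  also have "\<dots> = (\<Sum>z\<in>{y (Suc k)<..<y k}. f (y(k := z))) + f y - f (y(k := y (Suc k) + 1))"
    using sum_shift_open_int[OF assms(1), of "\<lambda>z. f (y(k := z))"] by simp
  finally have 1: "(\<Sum>z\<in>{y (Suc k)<..<y k}. f (jump b k (y(k := z)))) = \<dots>" .
  show ?thesis
  proof (cases "ahead b y k = y k + 1")
    case True
    then show ?thesis using 1 by (simp add: jump_def sum_subtractf pull_alt)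
  next
    case False
    have "{y (Suc k)<..<y k + 1} = insert (y k) {y (Suc k)<..<y k}" using assms by auto
    then show ?thesis using 1 False assms by (simp add: jump_def sum_subtractf pull_alt algebra_simps)
  qed
qed

text \<open>A jump of \<open>Suc k\<close> uses up the leftmost site of the gap; had particle
  \<open>k\<close> been pulled to that site, the jump would be blocked. This single term is the
  correction, and its first part cancels the lost site of \<open>pull_jump_self\<close>.\<close>

lemma pull_jump_next:
  assumes "y (Suc k) < y k"
  shows "(\<Sum>z\<in>{y (Suc k)<..<y k}. f (jump b (Suc k) (y(k := z))) - f (jump b (Suc k) y))
         = pull k f (jump b (Suc k) y) + f (y(k := y (Suc k) + 1)) - f (jump b (Suc k) y)"
proof (cases "y k = y (Suc k) + 1")
  case True
  then have "y(k := y (Suc k) + 1) = y" "jump b (Suc k) y = y" "{y (Suc k)<..<y k} = {}"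
    by (auto simp: jump_def ahead_def)
  then show ?thesis by (simp add: pull_def)
next
  case False
  let ?w = "y (Suc k)"
  have j: "jump b (Suc k) y = y(Suc k := ?w + 1)" using False by (simp add: jump_def ahead_def)
  have I: "{?w<..<y k} = insert (?w + 1) {?w + 1<..<y k}" using False assms by auto
  have j1: "jump b (Suc k) (y(k := ?w + 1)) = y(k := ?w + 1)" by (simp add: jump_def ahead_def)
  have j2: "jump b (Suc k) (y(k := z)) = (y(Suc k := ?w + 1))(k := z)" if "z \<in> {?w + 1<..<y k}" for z
    using that by (auto simp: jump_def ahead_def fun_eq_iff)
  have e1: "(\<Sum>z\<in>{?w<..<y k}. f (jump b (Suc k) (y(k := z))) - f (jump b (Suc k) y))
    = f (y(k := ?w + 1)) - f (jump b (Suc k) y)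
      + (\<Sum>z\<in>{?w + 1<..<y k}. f ((y(Suc k := ?w + 1))(k := z)) - f (jump b (Suc k) y))"
    unfolding I by (subst sum.insert) (simp_all add: j1 j2 del: greaterThanLessThan_iff, simp)
  have e2: "(\<Sum>z\<in>{?w + 1<..<y k}. f ((y(Suc k := ?w + 1))(k := z)) - f (jump b (Suc k) y))
    = pull k f (jump b (Suc k) y)" unfolding pull_def j by simp
  show ?thesis unfolding e1 e2 by simp
qed

text \<open>Summation by parts; this is the place where the rates \<open>k + 1\<close> are the right
  ones.\<close>

lemma sum_Suc_mult_diff:
  fixes g :: "nat \<Rightarrow> real"
  shows "(\<Sum>k<n. real (Suc k) * (g k - g (Suc k))) = (\<Sum>k<n. g k) - real n * g n"
  by (induction n) (auto simp: algebra_simps)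

lemma bwd_fwd_commutator:
  assumes y: "ordered b n y" and f: "\<And>z. f (y(n := z)) = f y"
  shows "bwd n (fwd b n f) y = fwd b n (bwd n f) y + fwd b n f y"
proof -
  have per: "pull k (fwd b n f) y
      = (\<Sum>j\<le>n. pull k f (jump b j y) - pull k f y) + f (jump b k y) - f (jump b (Suc k) y)"
    if k: "k < n" for k
  proof -
    let ?I = "{y (Suc k)<..<y k}"
    let ?D = "\<lambda>j. \<Sum>z\<in>?I. f (jump b j (y(k := z))) - f (jump b j y)"
    have o: "y (Suc k) < y k" "y k < ahead b y k"
      using y k ordered_Suc by (auto simp: ordered_def)
    have "pull k (fwd b n f) y
      = (\<Sum>z\<in>?I. \<Sum>j\<le>n. (f (jump b j (y(k := z))) - f (jump b j y)) - (f (y(k := z)) - f y))"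
      unfolding pull_def fwd_def sum_subtractf[symmetric] by (intro sum.cong refl) simp
    also have "\<dots> = (\<Sum>j\<le>n. \<Sum>z\<in>?I. (f (jump b j (y(k := z))) - f (jump b j y)) - (f (y(k := z)) - f y))"
      by (rule sum.swap)
    also have "\<dots> = (\<Sum>j\<le>n. ?D j - pull k f y)"
      unfolding pull_def by (simp add: sum_subtractf)
    also have "\<dots> = (\<Sum>j\<le>n. (pull k f (jump b j y) - pull k f y)
        + ((if j = k then f (jump b k y) - f (y(k := y (Suc k) + 1)) else 0)
        + (if j = Suc k then f (y(k := y (Suc k) + 1)) - f (jump b (Suc k) y) else 0)))"
    proof (intro sum.cong refl)
      fix j
      consider "j = k" | "j = Suc k" | "j \<noteq> k" "j \<noteq> Suc k" by blast
      then show "?D j - pull k f y = (pull k f (jump b j y) - pull k f y)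
        + ((if j = k then f (jump b k y) - f (y(k := y (Suc k) + 1)) else 0)
        + (if j = Suc k then f (y(k := y (Suc k) + 1)) - f (jump b (Suc k) y) else 0))"
        by cases (simp_all add: pull_jump_self[OF o] pull_jump_next[OF o(1)] pull_jump_other)
    qed
    also have "\<dots> = (\<Sum>j\<le>n. pull k f (jump b j y) - pull k f y) + f (jump b k y) - f (jump b (Suc k) y)"
      using k by (simp add: sum.distrib)
    finally show ?thesis .
  qed
  \<comment> \<open>Since \<open>f\<close> ignores particle \<open>n\<close>, the boundary term of
    the summation by parts becomes \<open>n\<close> copies of \<open>f y\<close>, just what
    \<open>fwd\<close> subtracts for the particles below \<open>n\<close>.\<close>
  have last: "f (jump b n y) = f y" by (simp add: jump_def f)
  have "bwd n (fwd b n f) y = (\<Sum>k<n. real (Suc k) * (\<Sum>j\<le>n. pull k f (jump b j y) - pull k f y))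
      + (\<Sum>k<n. real (Suc k) * (f (jump b k y) - f (jump b (Suc k) y)))"
    unfolding bwd_def sum.distrib[symmetric] by (intro sum.cong refl) (simp add: per algebra_simps)
  also have "(\<Sum>k<n. real (Suc k) * (\<Sum>j\<le>n. pull k f (jump b j y) - pull k f y)) = fwd b n (bwd n f) y"
    unfolding fwd_def bwd_def sum_subtractf[symmetric] sum_distrib_left
    by (subst sum.swap) (simp add: algebra_simps)
  also have "(\<Sum>k<n. real (Suc k) * (f (jump b k y) - f (jump b (Suc k) y))) = fwd b n f y"
    using sum_Suc_mult_diff[of "\<lambda>k. f (jump b k y)" n] last
    by (simp add: fwd_def sum_subtractf lessThan_Suc_atMost[symmetric] algebra_simps)
  finally show ?thesis .
qed

section \<open>The law of the order of the rings\<close>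

text \<open>Rings are counted from one: \<open>clock x i m\<close> is the time of ring
  \<open>m\<close>, and \<open>clock x i 0 = 0\<close> stands for the start.\<close>

definition clock :: "(nat \<times> nat \<Rightarrow> real) \<Rightarrow> nat \<Rightarrow> nat \<Rightarrow> real" where
  "clock x i m = (\<Sum>j<m. x (i, j))"

lemma clock_0 [simp]: "clock x i 0 = 0"
  by (simp add: clock_def)

text \<open>Words over the particle labels record the order of the rings, with the latest ring at the head.
  \<open>chain x w r\<close>: the rings listed in \<open>w\<close> occur in that order, strictly between times \<open>0\<close> and \<open>r\<close>.\<close>

primrec chain :: "(nat \<times> nat \<Rightarrow> real) \<Rightarrow> nat list \<Rightarrow> real \<Rightarrow> bool" where
  "chain x [] r \<longleftrightarrow> 0 < r"
| "chain x (i # w) r \<longleftrightarrow> clock x i (Suc (count_list w i)) < r \<and> chain x w (clock x i (Suc (count_list w i)))"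

text \<open>The indices of the waiting times completed by the rings in \<open>w\<close>;
  \<open>chain x w r\<close> depends on no others.\<close>

definition used :: "nat list \<Rightarrow> (nat \<times> nat) set" where
  "used w = {(i, j). j < count_list w i}"

lemma used_simps [simp]: "used [] = {}" "used (i # w) = insert (i, count_list w i) (used w)"
  by (auto simp: used_def less_Suc_eq split: if_splits)

lemma finite_used [simp]: "finite (used w)"
  by (induction w) auto

lemma not_used [simp]: "(i, count_list w i) \<notin> used w"
  by (simp add: used_def)

lemma clock_cong:
  assumes "\<And>j. j < m \<Longrightarrow> x (i, j) = x' (i, j)"
  shows "clock x i m = clock x' i m"
  using assms by (simp add: clock_def)

lemma chain_cong:
  assumes "\<And>p. p \<in> used w \<Longrightarrow> x p = x' p"
  shows "chain x w r = chain x' w r"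
  using assms
proof (induction w arbitrary: r)
  case (Cons i w)
  have "clock x i (Suc (count_list w i)) = clock x' i (Suc (count_list w i))"
    using Cons.prems by (intro clock_cong) (auto simp: used_def less_Suc_eq)
  then show ?case using Cons by simp
qed simp

lemma chain_clock_less: "chain x w r \<Longrightarrow> clock x i (count_list w i) < r"
  by (induction w arbitrary: r) (auto simp: clock_def intro: less_trans)

lemma measurable_clock [measurable]:
  assumes "\<And>j. j < m \<Longrightarrow> (i, j) \<in> J" "f \<in> measurable N (PiM J (\<lambda>_. borel))"
  shows "(\<lambda>\<omega>. clock (f \<omega>) i m) \<in> borel_measurable N"
  unfolding clock_def
proof (intro borel_measurable_sum)
  fix j assume "j \<in> {..<m}"
  then show "(\<lambda>\<omega>. f \<omega> (i, j)) \<in> borel_measurable N"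
    using measurable_compose[OF assms(2) measurable_component_singleton[of "(i, j)"]] assms(1) by simp
qed

lemma measurable_chain:
  assumes "used w \<subseteq> J" "f \<in> measurable N (PiM J (\<lambda>_. borel))" "g \<in> borel_measurable N"
  shows "Measurable.pred N (\<lambda>\<omega>. chain (f \<omega>) w (g \<omega>))"
  using assms(1,3)
proof (induction w arbitrary: g)
  case Nil
  note [measurable] = Nil(2)
  show ?case by simp
next
  case (Cons i w)
  note [measurable] = Cons(3)
  have [measurable]: "(\<lambda>\<omega>. clock (f \<omega>) i (Suc (count_list w i))) \<in> borel_measurable N"
    using Cons.prems(1) by (intro measurable_clock[OF _ assms(2)]) (auto simp: used_def less_Suc_eq)
  have [measurable]: "Measurable.pred N (\<lambda>\<omega>. chain (f \<omega>) w (clock (f \<omega>) i (Suc (count_list w i))))"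
    using Cons by simp
  show ?case by simp
qed

section \<open>Integration over ordered ring times\<close>

abbreviation std_exp :: "real measure" where
  "std_exp \<equiv> density lborel (\<lambda>u. ennreal (exponential_density 1 u))"

lemma prob_space_std_exp: "prob_space std_exp"
  by (rule prob_space_exponential_density) simp

lemma product_sigma_finite_std_exp: "product_sigma_finite (\<lambda>_. std_exp)"
  by (intro product_sigma_finite.intro prob_space_imp_sigma_finite prob_space_std_exp)

text \<open>The factor \<open>exp\<close> cancels the exponential densities, so that the integral of the weight is the
  volume of a simplex of ordered ring times.\<close>

definition chain_weight :: "nat list \<Rightarrow> real \<Rightarrow> (nat \<times> nat \<Rightarrow> real) \<Rightarrow> ennreal" where
  "chain_weight w r x = (if chain x w r then ennreal (exp (sum x (used w))) else 0)"

lemma sets_PiM_std_exp: "sets (PiM J (\<lambda>_. std_exp)) = sets (PiM J (\<lambda>_. borel))"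
  by (intro sets_PiM_cong) auto

lemma measurable_chain_weight:
  assumes "f \<in> measurable N (PiM (used w) (\<lambda>_. borel))" "g \<in> borel_measurable N"
  shows "(\<lambda>\<omega>. chain_weight w (g \<omega>) (f \<omega>)) \<in> borel_measurable N"
proof -
  have [measurable]: "Measurable.pred N (\<lambda>\<omega>. chain (f \<omega>) w (g \<omega>))"
    using assms by (intro measurable_chain) auto
  have [measurable]: "(\<lambda>\<omega>. sum (f \<omega>) (used w)) \<in> borel_measurable N"
    by (intro borel_measurable_sum measurable_compose[OF assms(1) measurable_component_singleton])
  show ?thesis unfolding chain_weight_def by simp
qed

text \<open>On \<open>u >= 0\<close> the factor \<open>exp u\<close> cancels the density, so
  integrating over a waiting time becomes Lebesgue integration over the ring time
  \<open>S + u\<close>. Negative \<open>u\<close> contribute to neither side because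
  \<open>g\<close> vanishes below \<open>S\<close>.\<close>

lemma std_exp_shift:
  assumes [measurable]: "g \<in> borel_measurable borel" and "\<And>r. r < S \<Longrightarrow> g r = 0"
  shows "(\<integral>\<^sup>+u. ennreal (exp u) * g (S + u) \<partial>std_exp) = (\<integral>\<^sup>+r. g r \<partial>lborel)"
proof -
  have "(\<integral>\<^sup>+u. ennreal (exp u) * g (S + u) \<partial>std_exp)
      = (\<integral>\<^sup>+u. ennreal (exponential_density 1 u) * (ennreal (exp u) * g (S + u)) \<partial>lborel)"
    by (subst nn_integral_density) auto
  also have "\<dots> = (\<integral>\<^sup>+u. g (S + u) \<partial>lborel)"
  proof (intro nn_integral_cong)
    fix u :: real
    show "ennreal (exponential_density 1 u) * (ennreal (exp u) * g (S + u)) = g (S + u)"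
      using assms(2)[of "S + u"]
      by (cases "u < 0") (auto simp: exponential_density_def mult.assoc[symmetric] ennreal_mult'[symmetric] exp_add[symmetric])
  qed
  also have "\<dots> = (\<integral>\<^sup>+r. g r \<partial>lborel)"
    using nn_integral_real_affine[of g 1 S] by simp
  finally show ?thesis .
qed

lemma nn_integral_power_fact:
  assumes "0 < t"
  shows "(\<integral>\<^sup>+r. (if r < t then ennreal (if 0 < r then r ^ m / fact m else 0) else 0) \<partial>lborel)
         = ennreal (t ^ Suc m / fact (Suc m))"
proof -
  have "(\<integral>\<^sup>+r. (if r < t then ennreal (if 0 < r then r ^ m / fact m else 0) else 0) \<partial>lborel)
     = (\<integral>\<^sup>+r. ennreal (r ^ m / fact m) * indicator {0..t} r \<partial>lborel)"
  proof (rule nn_integral_cong_AE)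
    have "AE r in lborel. r \<noteq> 0 \<and> r \<noteq> t"
      using AE_lborel_singleton[of 0] AE_lborel_singleton[of t] by auto
    then show "AE r in lborel. (if r < t then ennreal (if 0 < r then r ^ m / fact m else 0) else 0)
        = ennreal (r ^ m / fact m) * indicator {0..t} r"
      by eventually_elim (auto simp: indicator_def)
  qed
  also have "\<dots> = ennreal (t ^ Suc m / fact (Suc m) - 0 ^ Suc m / fact (Suc m))"
  proof (rule nn_integral_FTC_Icc[where F = "\<lambda>r. r ^ Suc m / fact (Suc m)"])
    fix r :: real assume "r \<in> {0..t}"
    show "((\<lambda>r. r ^ Suc m / fact (Suc m)) has_real_derivative r ^ m / fact m) (at r)"
    proof -
      have "fact (Suc m) = real (Suc m) * fact m" by (rule fact_Suc)
      then have "real (Suc m) * r ^ (Suc m - Suc 0) / fact (Suc m) = r ^ m / fact m"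
        by simp
      then show ?thesis
        using DERIV_cdivide[OF DERIV_pow[of "Suc m" r], of "fact (Suc m)"] by simp
    qed
  qed (use assms in auto)
  finally show ?thesis by simp
qed

text \<open>The waiting time behind the latest ring is integrated out and replaced by the ring time
  \<open>r\<close> itself. By Fubini the volume for \<open>i # w\<close> up to \<open>t\<close> is
  then the integral over \<open>r < t\<close> of the volume for \<open>w\<close> up to
  \<open>r\<close>, the recursion solved by \<open>t ^ m / fact m\<close>. The vanishing required by
  \<open>std_exp_shift\<close> is \<open>chain_clock_less\<close>.\<close>

lemma nn_integral_chain_weight:
  "(\<integral>\<^sup>+x. chain_weight w r x \<partial>PiM (used w) (\<lambda>_. std_exp))
   = ennreal (if 0 < r then r ^ length w / fact (length w) else 0)"
proof (induction w arbitrary: r)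
  case Nil
  interpret product_sigma_finite "\<lambda>_ :: nat \<times> nat. std_exp"
    by (rule product_sigma_finite_std_exp)
  show ?case by (simp add: chain_weight_def PiM_empty)
next
  case (Cons i w t)
  let ?P = "PiM (used w) (\<lambda>_. std_exp)"
  interpret product_sigma_finite "\<lambda>_ :: nat \<times> nat. std_exp"
    by (rule product_sigma_finite_std_exp)
  interpret finite_product_sigma_finite "\<lambda>_ :: nat \<times> nat. std_exp" "used w"
    by standard simp
  interpret pair_sigma_finite ?P lborel ..
  \<comment> \<open>Here \<open>r\<close> is the time of the latest ring, hence the time bound for
    the remaining word.\<close>
  let ?g = "\<lambda>x r. if r < t then chain_weight w r x else 0"
  have id: "(\<lambda>x. x) \<in> measurable ?P (PiM (used w) (\<lambda>_. borel))"
    by (intro measurable_ident_sets sets_PiM_std_exp)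
  have mg: "(\<lambda>(x, r). ?g x r) \<in> borel_measurable (?P \<Otimes>\<^sub>M lborel)"
  proof -
    have [measurable]: "(\<lambda>z. chain_weight w (snd z) (fst z)) \<in> borel_measurable (?P \<Otimes>\<^sub>M lborel)"
      by (rule measurable_chain_weight) (auto intro: measurable_compose[OF measurable_fst id])
    show ?thesis by (simp add: case_prod_beta)
  qed
  have "(\<integral>\<^sup>+x. chain_weight (i # w) t x \<partial>PiM (used (i # w)) (\<lambda>_. std_exp))
     = (\<integral>\<^sup>+x. \<integral>\<^sup>+u. chain_weight (i # w) t (x((i, count_list w i) := u)) \<partial>std_exp \<partial>?P)"
    unfolding used_simps(2)
    by (rule product_nn_integral_insert)
       (auto intro!: measurable_chain_weight measurable_ident_sets sets_PiM_std_exp simp del: used_simps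
             simp: used_simps(2)[symmetric])
  also have "\<dots> = (\<integral>\<^sup>+x. \<integral>\<^sup>+u. ennreal (exp u) * ?g x (clock x i (count_list w i) + u) \<partial>std_exp \<partial>?P)"
  proof (intro nn_integral_cong)
    fix x :: "nat \<times> nat \<Rightarrow> real" and u
    let ?x = "x((i, count_list w i) := u)"
    have c: "clock ?x i (Suc (count_list w i)) = clock x i (count_list w i) + u"
      by (simp add: clock_def)
    have d: "chain ?x w r = chain x w r" for r
      by (rule chain_cong) (auto simp: used_def)
    have "sum ?x (used w) = sum x (used w)"
      by (intro sum.cong) auto
    then have "sum ?x (used (i # w)) = sum x (used w) + u"
      by simp
    then show "chain_weight (i # w) t ?x = ennreal (exp u) * ?g x (clock x i (count_list w i) + u)"
      by (simp add: chain_weight_def c d exp_add ennreal_mult mult.commute)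
  qed
  also have "\<dots> = (\<integral>\<^sup>+x. \<integral>\<^sup>+r. ?g x r \<partial>lborel \<partial>?P)"
  proof (intro nn_integral_cong)
    fix x assume x: "x \<in> space ?P"
    have "(\<lambda>r. ?g x r) \<in> borel_measurable borel"
      using measurable_compose[OF measurable_Pair1'[OF x] mg] by simp
    then show "(\<integral>\<^sup>+u. ennreal (exp u) * ?g x (clock x i (count_list w i) + u) \<partial>std_exp) = (\<integral>\<^sup>+r. ?g x r \<partial>lborel)"
      by (rule std_exp_shift) (use chain_clock_less[of x w _ i] in \<open>fastforce simp: chain_weight_def\<close>)
  qed
  also have "\<dots> = (\<integral>\<^sup>+r. \<integral>\<^sup>+x. ?g x r \<partial>?P \<partial>lborel)"
    by (rule Fubini'[symmetric]) (rule mg)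
  also have "\<dots> = (\<integral>\<^sup>+r. (if r < t then ennreal (if 0 < r then r ^ length w / fact (length w) else 0) else 0) \<partial>lborel)"
    by (intro nn_integral_cong) (simp add: Cons.IH)
  also have "\<dots> = ennreal (if 0 < t then t ^ length (i # w) / fact (length (i # w)) else 0)"
  proof (cases "0 < t")
    case True
    then show ?thesis using nn_integral_power_fact[of t "length w"] by simp
  next
    case False
    have "(\<lambda>r. if r < t then ennreal (if 0 < r then r ^ length w / fact (length w) else 0) else 0) = (\<lambda>_. 0)"
      using False by (auto simp: fun_eq_iff)
    then show ?thesis using False by simp
  qed
  finally show ?case .
qed

section \<open>The probability of a given ring order\<close>

definition word_event :: "nat \<Rightarrow> nat list \<Rightarrow> real \<Rightarrow> (nat \<times> nat \<Rightarrow> real) \<Rightarrow> bool" where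
  "word_event n w t x \<longleftrightarrow> chain x w t \<and> (\<forall>i\<le>n. t < clock x i (Suc (count_list w i)))"

lemma emeasure_std_exp_tail:
  assumes "0 \<le> a"
  shows "emeasure std_exp {a<..} = ennreal (exp (- a))"
proof -
  interpret prob_space std_exp by (rule prob_space_std_exp)
  have "distributed std_exp lborel (\<lambda>x. x) (\<lambda>x. ennreal (exponential_density 1 x))"
    unfolding distributed_def
    by (auto simp: distr_id2[of lborel, simplified] intro!: distr_id2)
  from exponential_distributedD_gt[OF this assms] show ?thesis
    by (simp add: emeasure_eq_measure greaterThan_def)
qed

lemma word_event_cong:
  assumes "\<And>p. p \<in> used w \<union> (\<lambda>i. (i, count_list w i)) ` {..n} \<Longrightarrow> x p = x' p"
  shows "word_event n w t x = word_event n w t x'"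
proof -
  have "chain x w t = chain x' w t" using assms by (intro chain_cong) auto
  moreover have "clock x i (Suc (count_list w i)) = clock x' i (Suc (count_list w i))" if "i \<le> n" for i
    using assms that by (intro clock_cong) (force simp: used_def less_Suc_eq)
  ultimately show ?thesis by (simp add: word_event_def)
qed

lemma measurable_word_event:
  assumes "used w \<union> (\<lambda>i. (i, count_list w i)) ` {..n} \<subseteq> J"
  shows "Measurable.pred (PiM J (\<lambda>_. borel)) (word_event n w t)"
proof -
  let ?B = "PiM J (\<lambda>_. borel :: real measure)"
  have id: "(\<lambda>x. x) \<in> measurable ?B ?B" by simp
  have [measurable]: "Measurable.pred ?B (\<lambda>x. chain x w t)"
    using assms id by (intro measurable_chain[of w J "\<lambda>x. x"]) simp_all
  have [measurable]: "(\<lambda>x. clock x i (Suc (count_list w i))) \<in> borel_measurable ?B" if "i \<in> {..n}" for i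
  proof (rule measurable_clock[OF _ id])
    fix j assume "j < Suc (count_list w i)"
    then have "(i, j) \<in> used w \<or> j = count_list w i" by (auto simp: used_def)
    then show "(i, j) \<in> J" using assms that by blast
  qed
  have "Measurable.pred ?B (\<lambda>x. chain x w t \<and> (\<forall>i\<in>{..n}. t < clock x i (Suc (count_list w i))))"
    by measurable
  then show ?thesis unfolding word_event_def[abs_def] by simp
qed

lemma sum_used:
  assumes "set w \<subseteq> {..n}"
  shows "sum x (used w) = (\<Sum>i\<le>n. clock x i (count_list w i))"
proof -
  have "used w = Sigma {..n} (\<lambda>i. {..<count_list w i})"
    using assms by (auto simp: used_def) (metis atMost_iff count_list_0_iff not_less0 subsetD)
  then show ?thesis by (simp add: clock_def sum.Sigma)
qed

locale exp_clocks = prob_space M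
  for M :: "'w measure" and Z :: "nat \<times> nat \<Rightarrow> 'w \<Rightarrow> real" +
  assumes indep: "indep_vars (\<lambda>_. borel) Z UNIV"
    and dist: "\<And>p. distributed M lborel (Z p) (exponential_density 1)"
begin

lemma random_variable_Z [measurable]: "Z p \<in> borel_measurable M"
  using distributed_measurable[OF dist] by simp

lemma distr_restrict_Z:
  assumes "J \<noteq> {}"
  shows "distr M (PiM J (\<lambda>_. borel)) (\<lambda>\<omega>. \<lambda>p\<in>J. Z p \<omega>) = PiM J (\<lambda>_. std_exp)"
proof -
  have "distr M (PiM J (\<lambda>_. borel)) (\<lambda>\<omega>. \<lambda>p\<in>J. Z p \<omega>) = PiM J (\<lambda>p. distr M borel (Z p))"
    using indep_vars_subset[OF indep, of J] assms
    by (subst indep_vars_iff_distr_eq_PiM[symmetric]) auto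
  moreover have "distr M borel (Z p) = std_exp" for p
    using distributed_distr_eq_density[OF dist[of p]]
    by (metis distr_cong sets_lborel)
  ultimately show ?thesis by simp
qed

lemma measurable_restrict_Z [measurable]:
  "(\<lambda>\<omega>. \<lambda>p\<in>J. Z p \<omega>) \<in> measurable M (PiM J (\<lambda>_. borel))"
  by (intro measurable_restrict) simp

text \<open>Given the completed waiting times, each particle \<open>i\<close> at most
  \<open>n\<close> must have its running waiting time exceed \<open>t\<close> minus its last ring
  time. The product of these exponential tails is \<open>exp (- (n + 1) t)\<close> times the
  exponential of the sum over \<open>used w\<close> (see \<open>sum_used\<close>), that is, a
  constant times \<open>chain_weight\<close>.\<close>

lemma emeasure_word_event:
  assumes w: "set w \<subseteq> {..n}" and t: "0 < t"
  shows "emeasure M {\<omega> \<in> space M. word_event n w t (\<lambda>p. Z p \<omega>)}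
         = ennreal (exp (- (real (Suc n) * t)) * t ^ length w / fact (length w))"
proof -
  define c where "c i = (i, count_list w i)" for i
  \<comment> \<open>The waiting times still running at time \<open>t\<close>, one for each
    particle.\<close>
  define K where "K = c ` {..n}"
  define J where "J = used w \<union> K"
  have inj: "inj_on c {..n}" by (auto simp: c_def inj_on_def)
  have disj: "used w \<inter> K = {}" by (auto simp: K_def c_def)
  have fin: "finite K" by (simp add: K_def)
  have J: "J \<noteq> {}" by (auto simp: J_def K_def)
  have meas: "Measurable.pred (PiM J (\<lambda>_. borel)) (word_event n w t)"
    by (rule measurable_word_event) (auto simp: J_def K_def c_def)
  have meas': "Measurable.pred (PiM J (\<lambda>_. std_exp)) (word_event n w t)"
    using meas by (subst measurable_cong_sets[OF sets_PiM_std_exp refl])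
  interpret product_sigma_finite "\<lambda>_ :: nat \<times> nat. std_exp"
    by (rule product_sigma_finite_std_exp)
  have "emeasure M {\<omega> \<in> space M. word_event n w t (\<lambda>p. Z p \<omega>)}
    = emeasure M ((\<lambda>\<omega>. \<lambda>p\<in>J. Z p \<omega>) -` {x \<in> space (PiM J (\<lambda>_. borel)). word_event n w t x} \<inter> space M)"
  proof (rule arg_cong[where f = "emeasure M"])
    have "word_event n w t (\<lambda>p. Z p \<omega>) = word_event n w t (\<lambda>p\<in>J. Z p \<omega>)" for \<omega>
      by (rule word_event_cong) (auto simp: J_def K_def c_def)
    then show "{\<omega> \<in> space M. word_event n w t (\<lambda>p. Z p \<omega>)} =
        (\<lambda>\<omega>. \<lambda>p\<in>J. Z p \<omega>) -` {x \<in> space (PiM J (\<lambda>_. borel)). word_event n w t x} \<inter> space M"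
      by (auto simp: space_PiM)
  qed
  also have "\<dots> = emeasure (PiM J (\<lambda>_. std_exp)) {x \<in> space (PiM J (\<lambda>_. std_exp)). word_event n w t x}"
    unfolding distr_restrict_Z[OF J, symmetric] space_distr
    by (rule emeasure_distr[symmetric, OF measurable_restrict_Z meas[unfolded pred_def]])
  also have "\<dots> = (\<integral>\<^sup>+x. indicator {x \<in> space (PiM J (\<lambda>_. std_exp)). word_event n w t x} x \<partial>PiM J (\<lambda>_. std_exp))"
    by (rule nn_integral_indicator[symmetric, OF meas'[unfolded pred_def]])
  also have "\<dots> = (\<integral>\<^sup>+x. indicator {x. word_event n w t x} x \<partial>PiM J (\<lambda>_. std_exp))"
    by (intro nn_integral_cong) (simp add: indicator_def)
  also have "\<dots> = (\<integral>\<^sup>+x. \<integral>\<^sup>+z. indicator {x. word_event n w t x} (merge (used w) K (x, z))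
      \<partial>PiM K (\<lambda>_. std_exp) \<partial>PiM (used w) (\<lambda>_. std_exp))"
    using meas' unfolding J_def
    by (intro product_nn_integral_fold[OF disj _ fin]) (auto simp: indicator_def[abs_def])
  also have "\<dots> = (\<integral>\<^sup>+x. ennreal (exp (- (real (Suc n) * t))) * chain_weight w t x \<partial>PiM (used w) (\<lambda>_. std_exp))"
  proof (intro nn_integral_cong)
    fix x :: "nat \<times> nat \<Rightarrow> real"
    let ?s = "\<lambda>i. clock x i (count_list w i)"
    have 1: "indicator {x. word_event n w t x} (merge (used w) K (x, z))
      = (if chain x w t then 1 else 0) * (\<Prod>p\<in>K. indicator {t - ?s (fst p)<..} (z p) :: ennreal)" for z
    proof -
      let ?m = "merge (used w) K (x, z)"
      have a: "chain ?m w t = chain x w t" by (rule chain_cong) (auto simp: merge_def)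
      have b: "clock ?m i (Suc (count_list w i)) = ?s i + z (c i)" if "i \<le> n" for i
      proof -
        have "clock ?m i (count_list w i) = ?s i"
          by (rule clock_cong) (auto simp: merge_def used_def)
        moreover have "?m (i, count_list w i) = z (c i)"
          using that by (auto simp: merge_def c_def K_def)
        ultimately show ?thesis by (simp add: clock_def)
      qed
      have c: "(\<forall>i\<le>n. t < clock ?m i (Suc (count_list w i))) \<longleftrightarrow> (\<forall>p\<in>K. t - ?s (fst p) < z p)"
        using b by (auto simp: K_def c_def algebra_simps)
      have "(\<Prod>p\<in>K. indicator {t - ?s (fst p)<..} (z p) :: ennreal) = (if \<forall>p\<in>K. t - ?s (fst p) < z p then 1 else 0)"
        using fin by (auto simp: indicator_def prod_zero_iff)
      then show ?thesis using a c by (simp add: indicator_def word_event_def)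
    qed
    have 2: "(\<integral>\<^sup>+z. indicator {x. word_event n w t x} (merge (used w) K (x, z)) \<partial>PiM K (\<lambda>_. std_exp))
      = (if chain x w t then 1 else 0) * (\<integral>\<^sup>+z. (\<Prod>p\<in>K. indicator {t - ?s (fst p)<..} (z p)) \<partial>PiM K (\<lambda>_. std_exp))"
      unfolding 1 by (rule nn_integral_cmult) (auto intro!: borel_measurable_prod_ennreal measurable_compose[OF measurable_component_singleton])
    have 3: "(\<integral>\<^sup>+z. (\<Prod>p\<in>K. indicator {t - ?s (fst p)<..} (z p)) \<partial>PiM K (\<lambda>_. std_exp))
      = (\<Prod>p\<in>K. emeasure std_exp {t - ?s (fst p)<..})"
      using fin by (subst product_nn_integral_prod) auto
    show "(\<integral>\<^sup>+z. indicator {x. word_event n w t x} (merge (used w) K (x, z)) \<partial>PiM K (\<lambda>_. std_exp))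
      = ennreal (exp (- (real (Suc n) * t))) * chain_weight w t x"
    proof (cases "chain x w t")
      case True
      have "(\<Prod>p\<in>K. emeasure std_exp {t - ?s (fst p)<..}) = (\<Prod>i\<le>n. emeasure std_exp {t - ?s i<..})"
        unfolding K_def using inj by (subst prod.reindex) (auto simp: c_def)
      also have "\<dots> = (\<Prod>i\<le>n. ennreal (exp (?s i - t)))"
        using chain_clock_less[OF True] by (intro prod.cong refl) (subst emeasure_std_exp_tail, auto simp: less_imp_le)
      also have "\<dots> = ennreal (exp (\<Sum>i\<le>n. ?s i - t))"
        by (subst prod_ennreal) (auto simp: exp_sum)
      also have "(\<Sum>i\<le>n. ?s i - t) = - (real (Suc n) * t) + sum x (used w)"
        by (simp add: sum_used[OF w] sum_subtractf)
      also have "ennreal (exp (- (real (Suc n) * t) + sum x (used w)))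
          = ennreal (exp (- (real (Suc n) * t))) * ennreal (exp (sum x (used w)))"
        by (simp only: exp_add ennreal_mult exp_ge_zero)
      finally show ?thesis unfolding 2 3 chain_weight_def if_P[OF True] by (simp only: mult_1)
    qed (simp add: 2 chain_weight_def)
  qed
  also have "\<dots> = ennreal (exp (- (real (Suc n) * t))) * ennreal (t ^ length w / fact (length w))"
  proof (subst nn_integral_cmult)
    show "(\<lambda>x. chain_weight w t x) \<in> borel_measurable (PiM (used w) (\<lambda>_. std_exp))"
      by (rule measurable_chain_weight) (auto intro: measurable_ident_sets sets_PiM_std_exp)
  qed (use t in \<open>simp only: nn_integral_chain_weight if_True\<close>)
  also have "\<dots> = ennreal (exp (- (real (Suc n) * t)) * (t ^ length w / fact (length w)))"
    using t by (intro ennreal_mult[symmetric]) auto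
  finally show ?thesis by (simp only: times_divide_eq_right)
qed

end

section \<open>The forward semigroup from the step configuration\<close>

text \<open>\<open>foldr\<close> applies the last letter first, in agreement with the latest ring
  being the head of the word.\<close>

definition run :: "int \<Rightarrow> nat list \<Rightarrow> nat \<Rightarrow> int" where
  "run b w = foldr (jump b) w step_init"

definition words :: "nat \<Rightarrow> nat \<Rightarrow> nat list set" where
  "words n m = {w. set w \<subseteq> {..n} \<and> length w = m}"

lemma run_simps [simp]: "run b [] = step_init" "run b (i # w) = jump b i (run b w)"
  by (simp_all add: run_def)

lemma finite_words [simp]: "finite (words n m)"
  by (simp add: words_def finite_lists_length_eq)

lemma card_words: "card (words n m) = Suc n ^ m"
  by (simp add: words_def card_lists_length_eq)

lemma words_0 [simp]: "words n 0 = {[]}"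
  by (auto simp: words_def)

lemma sum_words_Suc: "(\<Sum>w\<in>words n (Suc m). g w) = (\<Sum>w\<in>words n m. \<Sum>i\<le>n. g (i # w))"
proof -
  have "words n (Suc m) = (\<lambda>(w, i). i # w) ` (words n m \<times> {..n})"
    by (auto simp: words_def length_Suc_conv image_iff)
  moreover have "inj_on (\<lambda>(w, i). i # w) (words n m \<times> {..n})"
    by (auto simp: inj_on_def)
  ultimately show ?thesis
    by (simp add: sum.reindex sum.cartesian_product case_prod_unfold)
qed

lemma ordered_run: "- 1 \<le> b \<Longrightarrow> ordered b n (run b w)"
proof (induction w)
  case Nil
  then show ?case by (auto simp: ordered_def ahead_def step_init_def split: nat.split)
qed (simp add: ordered_jump)

lemma run_ge: "step_init k \<le> run b w k"
  by (induction w) (auto simp: jump_def)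

lemma ordered_le:
  assumes "ordered b n y" "k \<le> n"
  shows "y k \<le> b"
  using assms(2)
proof (induction k)
  case 0
  then show ?case using assms(1) by (auto simp: ordered_def ahead_def)
next
  case (Suc k)
  then show ?case using ordered_Suc[OF assms(1), of k] by auto
qed

text \<open>Ring orders of length \<open>m\<close> on \<open>{..n}\<close> all have the probability
  \<open>exp (- (n + 1) t) t ^ m / m!\<close>, so \<open>mean\<close> is the expectation at time \<open>t\<close> as a power series; it makes sense
  for every real \<open>t\<close>.\<close>

definition moment :: "int \<Rightarrow> nat \<Rightarrow> ((nat \<Rightarrow> int) \<Rightarrow> real) \<Rightarrow> nat \<Rightarrow> real" where
  "moment b n F m = (\<Sum>w\<in>words n m. F (run b w))"

definition mean :: "int \<Rightarrow> nat \<Rightarrow> ((nat \<Rightarrow> int) \<Rightarrow> real) \<Rightarrow> real \<Rightarrow> real" where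
  "mean b n F t = exp (- (real (Suc n) * t)) * (\<Sum>m. moment b n F m / fact m * t ^ m)"

text \<open>Only reachable configurations count: \<open>bwd n f\<close> is in general unbounded over
  all configurations, since gaps can be arbitrarily large.\<close>

definition bounded_by :: "int \<Rightarrow> nat \<Rightarrow> real \<Rightarrow> ((nat \<Rightarrow> int) \<Rightarrow> real) \<Rightarrow> bool" where
  "bounded_by b n C F \<longleftrightarrow> (\<forall>w. set w \<subseteq> {..n} \<longrightarrow> \<bar>F (run b w)\<bar> \<le> C)"

lemma moment_fwd: "moment b n (fwd b n F) m = moment b n F (Suc m) - real (Suc n) * moment b n F m"
  unfolding moment_def fwd_def sum_words_Suc
  by (simp add: sum_subtractf sum_distrib_left)

lemma abs_moment_le:
  assumes "bounded_by b n C F"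
  shows "\<bar>moment b n F m\<bar> \<le> C * real (Suc n) ^ m"
proof -
  have "\<bar>moment b n F m\<bar> \<le> (\<Sum>w\<in>words n m. \<bar>F (run b w)\<bar>)"
    unfolding moment_def by (rule sum_abs)
  also have "\<dots> \<le> (\<Sum>w\<in>words n m. C)"
    using assms by (intro sum_mono) (auto simp: bounded_by_def words_def)
  also have "\<dots> = C * real (Suc n) ^ m"
    by (simp only: sum_constant card_words of_nat_power mult.commute)
  finally show ?thesis .
qed

lemma exp_sums: "(\<lambda>m. C * (c ^ m / fact m)) sums (C * exp c)" for c :: real
  using sums_mult[OF exp_converges[of c], of C] by (simp add: divide_inverse mult_ac)

lemma moment_term_le:
  assumes "bounded_by b n C F"
  shows "norm (moment b n F m / fact m * t ^ m) \<le> C * ((real (Suc n) * \<bar>t\<bar>) ^ m / fact m)"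
proof -
  have "norm (moment b n F m / fact m * t ^ m) = \<bar>moment b n F m\<bar> * \<bar>t\<bar> ^ m / fact m"
    by (simp add: abs_mult power_abs)
  also have "\<dots> \<le> (C * real (Suc n) ^ m) * \<bar>t\<bar> ^ m / fact m"
    by (intro divide_right_mono mult_right_mono abs_moment_le[OF assms]) auto
  finally show ?thesis by (simp only: power_mult_distrib mult.assoc times_divide_eq_right)
qed

lemma summable_moment:
  assumes "bounded_by b n C F"
  shows "summable (\<lambda>m. moment b n F m / fact m * t ^ m)"
  by (rule summable_comparison_test'[OF sums_summable[OF exp_sums]]) (rule moment_term_le[OF assms])

text \<open>The factor 2 allows for negative \<open>t\<close>: one exponential bounds the power
  series, the other the prefactor.\<close>

lemma abs_mean_le:
  assumes "bounded_by b n C F"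
  shows "\<bar>mean b n F t\<bar> \<le> C * exp (2 * real (Suc n) * \<bar>t\<bar>)"
proof -
  let ?N = "real (Suc n)"
  have C: "0 \<le> C" using assms[unfolded bounded_by_def, rule_format, of "[]"] by simp
  have "\<bar>\<Sum>m. moment b n F m / fact m * t ^ m\<bar> \<le> C * exp (?N * \<bar>t\<bar>)"
    using norm_suminf_le[OF moment_term_le[OF assms, of _ t] sums_summable[OF exp_sums]]
      sums_unique[OF exp_sums[of C "?N * \<bar>t\<bar>"]] by simp
  then have "\<bar>mean b n F t\<bar> \<le> exp (- (?N * t)) * (C * exp (?N * \<bar>t\<bar>))"
    unfolding mean_def abs_mult abs_exp_cancel by (intro mult_left_mono) auto
  also have "\<dots> \<le> exp (?N * \<bar>t\<bar>) * (C * exp (?N * \<bar>t\<bar>))"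
  proof (intro mult_right_mono)
    have "?N * - t \<le> ?N * \<bar>t\<bar>" by (intro mult_left_mono) auto
    then show "exp (- (?N * t)) \<le> exp (?N * \<bar>t\<bar>)" by simp
  qed (use C in simp)
  also have "\<dots> = C * exp (?N * \<bar>t\<bar> + ?N * \<bar>t\<bar>)" by (simp only: exp_add mult.left_commute)
  finally show ?thesis by (simp add: algebra_simps)
qed

text \<open>Kolmogorov's equation at the level of coefficients: differentiating the series shifts
  the moments, differentiating the prefactor subtracts \<open>n + 1\<close> times the series, and by
  \<open>moment_fwd\<close> the difference is the series of \<open>fwd b n F\<close>.\<close>

lemma has_derivative_mean:
  assumes F: "bounded_by b n C F"
  shows "(mean b n F has_real_derivative mean b n (fwd b n F) t) (at t)"
proof -
  let ?N = "real (Suc n)"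
  let ?c = "\<lambda>m. moment b n F m / fact m"
  have "((\<lambda>t. \<Sum>m. ?c m * t ^ m) has_real_derivative (\<Sum>m. diffs ?c m * t ^ m)) (at t)"
    by (rule termdiffs_strong_converges_everywhere) (rule summable_moment[OF F])
  moreover have "diffs ?c m = moment b n F (Suc m) / fact m" for m
    by (simp add: diffs_def divide_simps)
  ultimately have 1: "((\<lambda>t. \<Sum>m. ?c m * t ^ m) has_real_derivative
      (\<Sum>m. moment b n F (Suc m) / fact m * t ^ m)) (at t)"
    by simp
  have 2: "((\<lambda>t. exp (- (?N * t))) has_real_derivative - ?N * exp (- (?N * t))) (at t)"
    by (auto intro!: derivative_eq_intros)
  have s: "summable (\<lambda>m. moment b n F (Suc m) / fact m * t ^ m)"
    using termdiff_converges_all[OF summable_moment[OF F], of t]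
    by (simp add: diffs_def divide_simps)
  have "moment b n (fwd b n F) m / fact m * t ^ m
      = moment b n F (Suc m) / fact m * t ^ m - ?N * (?c m * t ^ m)" for m
    by (simp add: moment_fwd field_simps)
  then have "(\<Sum>m. moment b n (fwd b n F) m / fact m * t ^ m)
      = (\<Sum>m. moment b n F (Suc m) / fact m * t ^ m) - ?N * (\<Sum>m. ?c m * t ^ m)"
    using s summable_moment[OF F, of t]
    by (simp only: suminf_diff[OF s summable_mult[OF summable_moment[OF F]], symmetric] suminf_mult[OF summable_moment[OF F], symmetric])
  moreover have "e * (S1 - N * S0) = - N * e * S0 + S1 * e" for S0 S1 N e :: real
    by (simp add: algebra_simps)
  ultimately have "mean b n (fwd b n F) t = - ?N * exp (- (?N * t)) * (\<Sum>m. ?c m * t ^ m)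
      + (\<Sum>m. moment b n F (Suc m) / fact m * t ^ m) * exp (- (?N * t))"
    unfolding mean_def by (simp only:)
  moreover have "mean b n F = (\<lambda>t. exp (- (?N * t)) * (\<Sum>m. ?c m * t ^ m))"
    by (rule ext) (rule mean_def)
  ultimately show ?thesis
    using DERIV_mult[OF 2 1] by (simp only:)
qed

lemma mean_0 [simp]: "mean b n F 0 = F step_init"
proof -
  have "(\<Sum>m. moment b n F m / fact m * 0 ^ m) = moment b n F 0"
    using powser_zero[of "\<lambda>m. moment b n F m / fact m"] by simp
  then show ?thesis by (simp add: mean_def moment_def)
qed

lemma mean_cong:
  assumes "\<And>w. F (run b w) = G (run b w)"
  shows "mean b n F t = mean b n G t"
  using assms by (simp add: mean_def moment_def)

lemma mean_add:
  assumes "bounded_by b n C F" "bounded_by b n D G"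
  shows "mean b n (\<lambda>y. F y + G y) t = mean b n F t + mean b n G t"
proof -
  have "(\<Sum>m. moment b n (\<lambda>y. F y + G y) m / fact m * t ^ m)
     = (\<Sum>m. moment b n F m / fact m * t ^ m + moment b n G m / fact m * t ^ m)"
    by (simp add: moment_def sum.distrib field_simps)
  then show ?thesis
    unfolding mean_def
    by (simp only: suminf_add[OF summable_moment[OF assms(1), of t] summable_moment[OF assms(2), of t], symmetric]
        distrib_left)
qed

lemma abs_fwd_le:
  assumes "\<And>y. \<bar>f y\<bar> \<le> C"
  shows "\<bar>fwd b n f y\<bar> \<le> 2 * real (Suc n) * C"
proof -
  have "\<bar>fwd b n f y\<bar> \<le> (\<Sum>k\<le>n. \<bar>f (jump b k y) - f y\<bar>)" unfolding fwd_def by (rule sum_abs)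
  also have "\<dots> \<le> (\<Sum>k\<le>n. 2 * C)"
  proof (intro sum_mono)
    fix k show "\<bar>f (jump b k y) - f y\<bar> \<le> 2 * C"
      using assms[of "jump b k y"] assms[of y] by linarith
  qed
  finally show ?thesis by (simp add: algebra_simps)
qed

text \<open>The wall bounds particle \<open>k\<close> from above and its initial site bounds
  particle \<open>k + 1\<close> from below, so every gap has at most \<open>b + n + 2\<close> sites.
  There are \<open>n\<close> gaps, with rates at most \<open>n\<close>, and each move changes
  \<open>f\<close> by at most \<open>2 * C\<close>.\<close>

lemma bounded_by_bwd:
  assumes b: "- 1 \<le> b" and f: "\<And>y. \<bar>f y\<bar> \<le> C"
  shows "bounded_by b n (C * (2 * real n * real n * (real_of_int b + real n + 2))) (bwd n f)"
  unfolding bounded_by_def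
proof (intro allI impI)
  fix w :: "nat list"
  let ?y = "run b w" and ?D = "real_of_int b + real n + 2"
  have C: "0 \<le> C" using f[of ?y] by linarith
  have "\<bar>real (Suc k) * pull k f ?y\<bar> \<le> real n * (?D * (2 * C))" if k: "k < n" for k
  proof -
    have "?y k \<le> b" using ordered_le[OF ordered_run[OF b, of n w]] k by simp
    moreover have "- 1 - int (Suc k) \<le> ?y (Suc k)" using run_ge[of "Suc k" b w] by (simp add: step_init_def)
    ultimately have "int (card {?y (Suc k)<..<?y k}) \<le> b + int n + 2" using k b by simp
    then have c: "real (card {?y (Suc k)<..<?y k}) \<le> ?D"
      by linarith
    have "\<bar>pull k f ?y\<bar> \<le> (\<Sum>z\<in>{?y (Suc k)<..<?y k}. \<bar>f (?y(k := z)) - f ?y\<bar>)"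
      unfolding pull_def by (rule sum_abs)
    also have "\<dots> \<le> (\<Sum>z\<in>{?y (Suc k)<..<?y k}. 2 * C)"
    proof (intro sum_mono)
      fix z show "\<bar>f (?y(k := z)) - f ?y\<bar> \<le> 2 * C"
        using f[of "?y(k := z)"] f[of ?y] by linarith
    qed
    also have "\<dots> \<le> ?D * (2 * C)"
      unfolding sum_constant using c C by (intro mult_right_mono) auto
    finally have "\<bar>pull k f ?y\<bar> \<le> ?D * (2 * C)" .
    then show ?thesis unfolding abs_mult using k by (intro mult_mono) auto
  qed
  then have "\<bar>bwd n f ?y\<bar> \<le> (\<Sum>k<n. real n * (?D * (2 * C)))"
    unfolding bwd_def by (intro order.trans[OF sum_abs sum_mono]) auto
  then show "\<bar>bwd n f ?y\<bar> \<le> C * (2 * real n * real n * ?D)" by (simp add: algebra_simps)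
qed

lemma fwd_indep:
  assumes f: "\<And>y z. f (y(n := z)) = f y"
  shows "fwd b n f (y(n := z)) = fwd b n f y"
  unfolding fwd_def
proof (intro sum.cong refl arg_cong2[where f = "(-)"] f)
  fix k assume "k \<in> {..n}"
  show "f (jump b k (y(n := z))) = f (jump b k y)"
  proof (cases "k = n")
    case True
    then show ?thesis by (simp add: jump_def f)
  next
    case False
    with \<open>k \<in> {..n}\<close> have "k < n" by simp
    then have "jump b k (y(n := z)) = (jump b k y)(n := z)"
      by (auto simp: jump_def ahead_def fun_eq_iff split: nat.split)
    then show ?thesis by (simp add: f)
  qed
qed

text \<open>With \<open>u f t\<close> for the left-hand side, the commutation relation gives \<open>(u f)' = u (fwd f)\<close>, and \<open>u f 0 = 0\<close>
  because the step configuration has no gaps. All Taylor coefficients of \<open>u f\<close> at \<open>0\<close> thus vanish.\<close>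

theorem mean_bwd:
  assumes b: "- 1 \<le> b" and bd: "\<And>y. \<bar>f y\<bar> \<le> C" and ind: "\<And>y z. f (y(n := z)) = f y"
  shows "mean b n (bwd n f) t + t * mean b n (fwd b n f) t = 0"
proof -
  let ?N = "real (Suc n)"
  define K where "K = 2 * real n * real n * (real_of_int b + real n + 2)"
  define g where "g m = ((fwd b n) ^^ m) f" for m
  define u where "u m s = mean b n (bwd n (g m)) s + s * mean b n (fwd b n (g m)) s" for m s
  have gS: "fwd b n (g m) = g (Suc m)" for m by (simp add: g_def)
  have g_bd: "\<bar>g m y\<bar> \<le> C * (2 * ?N) ^ m" for m y
  proof (induction m arbitrary: y)
    case (Suc m)
    from abs_fwd_le[of "g m", OF Suc.IH] show ?case by (simp add: gS[symmetric] mult_ac)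
  qed (simp add: g_def bd)
  have g_ind: "g m (y(n := z)) = g m y" for m y z
    by (induction m arbitrary: y z) (use ind fwd_indep[of "g _" n b] in \<open>auto simp: g_def\<close>)
  have g_by: "bounded_by b n (C * (2 * ?N) ^ m) (g m)" for m
    using g_bd by (simp add: bounded_by_def)
  have b_by: "bounded_by b n (C * (2 * ?N) ^ m * K) (bwd n (g m))" for m
    unfolding K_def by (rule bounded_by_bwd[OF b g_bd])
  have comm: "mean b n (bwd n (g (Suc m))) s = mean b n (fwd b n (bwd n (g m))) s + mean b n (g (Suc m)) s" for m s
  proof -
    let ?L = "fwd b n (bwd n (g m))" and ?C = "C * (2 * ?N) ^ Suc m"
    have eq: "bwd n (g (Suc m)) (run b w) = ?L (run b w) + g (Suc m) (run b w)" for w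
      using bwd_fwd_commutator[where f = "g m", OF ordered_run[OF b] g_ind] by (simp only: gS)
    \<comment> \<open>The commutation relation writes \<open>?L\<close> as a difference of two
      functions already bounded.\<close>
    have "bounded_by b n (?C * K + ?C) ?L"
      unfolding bounded_by_def
    proof (intro allI impI)
      fix w :: "nat list" assume w: "set w \<subseteq> {..n}"
      have "\<bar>bwd n (g (Suc m)) (run b w)\<bar> \<le> ?C * K" "\<bar>g (Suc m) (run b w)\<bar> \<le> ?C"
        using b_by[of "Suc m"] g_by[of "Suc m"] w unfolding bounded_by_def by blast+
      then show "\<bar>?L (run b w)\<bar> \<le> ?C * K + ?C" unfolding eq by linarith
    qed
    then have "mean b n (\<lambda>y. ?L y + g (Suc m) y) s = mean b n ?L s + mean b n (g (Suc m)) s"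
      by (rule mean_add[OF _ g_by])
    moreover have "mean b n (bwd n (g (Suc m))) s = mean b n (\<lambda>y. ?L y + g (Suc m) y) s"
      by (rule mean_cong) (rule eq)
    ultimately show ?thesis by simp
  qed
  \<comment> \<open>The product rule applied to \<open>s * mean ...\<close> yields an extra
    \<open>mean b n (g (Suc m)) s\<close>, which is exactly the commutator term in
    \<open>comm\<close>.\<close>
  have du: "(u m has_real_derivative u (Suc m) s) (at s)" for m s
  proof -
    have "((\<lambda>s. mean b n (bwd n (g m)) s + s * mean b n (g (Suc m)) s) has_real_derivative
        mean b n (fwd b n (bwd n (g m))) s
        + (1 * mean b n (g (Suc m)) s + mean b n (fwd b n (g (Suc m))) s * s)) (at s)"
      by (intro DERIV_add DERIV_mult DERIV_ident has_derivative_mean[OF b_by] has_derivative_mean[OF g_by])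
    moreover have "u m = (\<lambda>s. mean b n (bwd n (g m)) s + s * mean b n (g (Suc m)) s)"
      by (rule ext) (simp add: u_def gS)
    ultimately show ?thesis by (simp add: u_def comm gS algebra_simps)
  qed
  have u0: "u m 0 = 0" for m
  proof -
    have "{step_init (Suc k)<..<step_init k} = {}" for k by (auto simp: step_init_def)
    then show ?thesis by (simp add: u_def bwd_def pull_def)
  qed
  \<comment> \<open>Growth in \<open>m\<close> is only geometric, so the factorial in the Taylor
    remainder wins.\<close>
  have u_le: "\<bar>u m s\<bar> \<le> (C * (K + 2 * ?N * \<bar>s\<bar>) * exp (2 * ?N * \<bar>s\<bar>)) * (2 * ?N) ^ m" for m s
  proof -
    have "\<bar>u m s\<bar> \<le> \<bar>mean b n (bwd n (g m)) s\<bar> + \<bar>s\<bar> * \<bar>mean b n (g (Suc m)) s\<bar>"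
      unfolding u_def gS by (metis abs_mult abs_triangle_ineq)
    also have "\<dots> \<le> C * (2 * ?N) ^ m * K * exp (2 * ?N * \<bar>s\<bar>) + \<bar>s\<bar> * (C * (2 * ?N) ^ Suc m * exp (2 * ?N * \<bar>s\<bar>))"
      by (intro add_mono mult_left_mono abs_mean_le b_by g_by) auto
    also have "\<dots> = (C * (K + 2 * ?N * \<bar>s\<bar>) * exp (2 * ?N * \<bar>s\<bar>)) * (2 * ?N) ^ m"
      by (simp add: algebra_simps)
    finally show ?thesis .
  qed
  define E where "E = C * (K + 2 * ?N * \<bar>t\<bar>) * exp (2 * ?N * \<bar>t\<bar>)"
  have C0: "0 \<le> C" using bd[of undefined] by linarith
  have K0: "0 \<le> K" using b by (simp add: K_def)
  have le: "\<bar>u 0 t\<bar> \<le> E * ((2 * ?N * \<bar>t\<bar>) ^ m / fact m)" for m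
  proof -
    obtain s where s: "\<bar>s\<bar> \<le> \<bar>t\<bar>" "u 0 t = (\<Sum>k<m. (u k 0 / fact k) * t ^ k) + (u m s / fact m) * t ^ m"
      using Maclaurin_all_le[of u "u 0" t m] du by auto
    have "\<bar>u m s\<bar> \<le> E * (2 * ?N) ^ m"
    proof (rule order.trans[OF u_le mult_right_mono])
      show "C * (K + 2 * ?N * \<bar>s\<bar>) * exp (2 * ?N * \<bar>s\<bar>) \<le> E"
        unfolding E_def using s(1) C0 K0 by (intro mult_mono add_left_mono mult_left_mono) auto
    qed simp
    then have "\<bar>u m s\<bar> / fact m * \<bar>t\<bar> ^ m \<le> E * (2 * ?N) ^ m / fact m * \<bar>t\<bar> ^ m"
      by (intro mult_right_mono divide_right_mono) auto
    moreover have "\<bar>u m s / fact m * t ^ m\<bar> = \<bar>u m s\<bar> / fact m * \<bar>t\<bar> ^ m"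
      by (simp add: abs_mult power_abs)
    ultimately have "\<bar>u m s / fact m * t ^ m\<bar> \<le> E * (2 * ?N) ^ m / fact m * \<bar>t\<bar> ^ m"
      by simp
    also have "\<dots> = E * ((2 * ?N * \<bar>t\<bar>) ^ m / fact m)"
      by (simp only: power_mult_distrib times_divide_eq_left times_divide_eq_right mult.assoc)
    finally show ?thesis using s(2) by (simp only: u0 div_0 mult_zero_left sum.neutral_const add_0_left)
  qed
  have "(\<lambda>m. E * ((2 * ?N * \<bar>t\<bar>) ^ m / fact m)) \<longlonglongrightarrow> 0"
    by (rule summable_LIMSEQ_zero[OF sums_summable[OF exp_sums]])
  then have "\<bar>u 0 t\<bar> \<le> 0"
    by (rule LIMSEQ_le_const) (use le in auto)
  then show ?thesis by (simp add: u_def g_def)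
qed

section \<open>Almost every clock sample has a unique ring order\<close>

lemma chain_pos: "chain x w r \<Longrightarrow> 0 < r"
  by (induction w arbitrary: r) (auto intro: less_trans)

text \<open>All inequalities in a chain are strict, which leaves room for an earlier time bound;
  left limits of trajectories are read off there.\<close>

lemma chain_left:
  assumes "chain x w s"
  shows "\<exists>a. 0 < a \<and> a < s \<and> chain x w a"
proof (cases w)
  case Nil
  then show ?thesis using assms by (intro exI[of _ "s / 2"]) auto
next
  case (Cons i u)
  define c where "c = clock x i (Suc (count_list u i))"
  have "c < s" "chain x u c" using assms Cons by (auto simp: c_def)
  then show ?thesis using chain_pos[of x u c] Cons
    by (intro exI[of _ "(c + s) / 2"]) (auto simp: c_def[symmetric])
qed

lemma clock_strict_mono:
  assumes "\<And>p. 0 < x p" "m < m'"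
  shows "clock x i m < clock x i m'"
  by (rule lift_Suc_mono_less[OF _ assms(2)]) (simp add: clock_def assms(1))

text \<open>The head is the latest ring. With equal counts but different heads, the last ring of
  each head would strictly precede that of the other.\<close>

lemma chain_unique:
  assumes "\<And>p. 0 < x p" "chain x w r" "chain x w' r'" "\<And>i. count_list w i = count_list w' i"
  shows "w = w'"
  using assms(2-4)
proof (induction w arbitrary: w' r r')
  case Nil
  then have "set w' = {}" by (metis count_list.simps(1) count_list_0_iff equals0I)
  then show ?case by simp
next
  case (Cons i u)
  have "i \<in> set w'" using Cons.prems(3)[of i] by (metis count_list_0_iff list.set_intros(1))
  then obtain i' u' where w': "w' = i' # u'" by (cases w') auto
  have "i = i'"
  proof (rule ccontr)
    assume ne: "i \<noteq> i'"
    have c: "count_list u' i = Suc (count_list u i)" "count_list u i' = Suc (count_list u' i')"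
      using Cons.prems(3)[of i] Cons.prems(3)[of i'] ne w' by auto
    have "clock x i (count_list u' i) < clock x i' (Suc (count_list u' i'))"
      using Cons.prems(2) w' by (auto intro: chain_clock_less)
    moreover have "clock x i' (count_list u i') < clock x i (Suc (count_list u i))"
      using Cons.prems(1) by (auto intro: chain_clock_less)
    ultimately show False using c by simp
  qed
  moreover have "u = u'"
  proof (rule Cons.IH)
    show "chain x u (clock x i (Suc (count_list u i)))" "chain x u' (clock x i' (Suc (count_list u' i')))"
      using Cons.prems(1,2) w' by auto
    show "count_list u j = count_list u' j" for j
      using Cons.prems(3)[of j] w' \<open>i = i'\<close> by (auto split: if_splits)
  qed
  ultimately show ?case using w' by simp
qed

text \<open>The time \<open>t\<close> lies strictly between two consecutive rings of each clock,
  which determines the counts; the counts determine the word.\<close>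

lemma word_event_unique:
  assumes pos: "\<And>p. 0 < x p" and w: "word_event n w t x" "set w \<subseteq> {..n}"
    and w': "word_event n w' t x" "set w' \<subseteq> {..n}"
  shows "w = w'"
proof (rule chain_unique[OF pos])
  show "chain x w t" "chain x w' t" using w w' by (auto simp: word_event_def)
  have le: "count_list v i \<le> count_list v' i"
    if "chain x v t" "word_event n v' t x" "i \<le> n" for v v' i
  proof (rule ccontr)
    assume "\<not> count_list v i \<le> count_list v' i"
    then consider "Suc (count_list v' i) = count_list v i" | "Suc (count_list v' i) < count_list v i" by linarith
    then have "clock x i (Suc (count_list v' i)) \<le> clock x i (count_list v i)"
      by cases (auto intro: less_imp_le clock_strict_mono[OF pos])
    then show False using that chain_clock_less[of x v t i] by (force simp: word_event_def)
  qed
  fix i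
  show "count_list w i = count_list w' i"
  proof (cases "i \<le> n")
    case True
    then show ?thesis using le[of w w' i] le[of w' w i] w w' by (force simp: word_event_def)
  next
    case False
    then have "i \<notin> set w" "i \<notin> set w'" using w w' by auto
    then show ?thesis by simp
  qed
qed

context exp_clocks
begin

lemma AE_pos: "AE \<omega> in M. \<forall>p. 0 < Z p \<omega>"
proof (subst AE_all_countable, intro allI)
  fix p
  have "prob {\<omega> \<in> space M. 0 < Z p \<omega>} = 1"
    using exponential_distributedD_gt[OF dist[of p], of 0] by simp
  then show "AE \<omega> in M. 0 < Z p \<omega>"
    by (subst (asm) prob_Collect_eq_1) auto
qed

text \<open>Positivity of the waiting times is built in so that the sets of different words are
  disjoint, not merely almost surely.\<close>

definition word_set :: "nat \<Rightarrow> real \<Rightarrow> nat list \<Rightarrow> 'w set" where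
  "word_set n t w = {\<omega> \<in> space M. (\<forall>p. 0 < Z p \<omega>) \<and> word_event n w t (\<lambda>p. Z p \<omega>)}"

lemma sets_word_event: "{\<omega> \<in> space M. word_event n w t (\<lambda>p. Z p \<omega>)} \<in> sets M"
proof -
  define J where "J = used w \<union> (\<lambda>i. (i, count_list w i)) ` {..n}"
  have "Measurable.pred M (\<lambda>\<omega>. word_event n w t (\<lambda>p\<in>J. Z p \<omega>))"
    using measurable_compose[OF measurable_restrict_Z measurable_word_event[of w n J t]]
    by (simp add: J_def)
  moreover have "word_event n w t (\<lambda>p. Z p \<omega>) = word_event n w t (\<lambda>p\<in>J. Z p \<omega>)" for \<omega>
    by (rule word_event_cong) (auto simp: J_def)
  ultimately show ?thesis by (simp add: pred_def)
qed

lemma sets_word_set [measurable]: "word_set n t w \<in> sets M"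
proof -
  have "word_set n t w = {\<omega> \<in> space M. \<forall>p. 0 < Z p \<omega>} \<inter> {\<omega> \<in> space M. word_event n w t (\<lambda>p. Z p \<omega>)}"
    by (auto simp: word_set_def)
  moreover have "{\<omega> \<in> space M. \<forall>p. 0 < Z p \<omega>} \<in> sets M" by measurable
  ultimately show ?thesis using sets_word_event by simp
qed

lemma prob_word_set:
  assumes "set w \<subseteq> {..n}" "0 < t"
  shows "prob (word_set n t w) = exp (- (real (Suc n) * t)) * t ^ length w / fact (length w)"
proof -
  have "emeasure M (word_set n t w) = emeasure M {\<omega> \<in> space M. word_event n w t (\<lambda>p. Z p \<omega>)}"
    using AE_pos by (intro emeasure_eq_AE sets_word_set sets_word_event) (auto simp: word_set_def)
  then show ?thesis
    using emeasure_word_event[OF assms] assms by (simp add: measure_def)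
qed

lemma word_set_disjoint:
  assumes "set w \<subseteq> {..n}" "set w' \<subseteq> {..n}" "w \<noteq> w'"
  shows "word_set n t w \<inter> word_set n t w' = {}"
  using word_event_unique[of "\<lambda>p. Z p _" n w t w'] assms by (auto simp: word_set_def)

text \<open>All \<open>(n + 1) ^ m\<close> words are equally likely, so the number of rings is
  Poisson with mean \<open>(n + 1) t\<close>.\<close>

lemma prob_words_union:
  assumes "0 < t"
  shows "prob (\<Union>w\<in>words n m. word_set n t w) = exp (- (real (Suc n) * t)) * ((real (Suc n) * t) ^ m / fact m)"
proof -
  have "prob (\<Union>w\<in>words n m. word_set n t w) = (\<Sum>w\<in>words n m. prob (word_set n t w))"
  proof (rule finite_measure_finite_Union)
    show "disjoint_family_on (word_set n t) (words n m)"
      unfolding disjoint_family_on_def words_def by (intro ballI impI word_set_disjoint) auto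
  qed auto
  also have "\<dots> = (\<Sum>w\<in>words n m. exp (- (real (Suc n) * t)) * t ^ m / fact m)"
    using prob_word_set[OF _ assms] by (intro sum.cong refl) (auto simp: words_def)
  also have "\<dots> = real (Suc n) ^ m * (exp (- (real (Suc n) * t)) * t ^ m / fact m)"
    by (simp only: sum_constant card_words of_nat_power)
  finally show ?thesis by (simp only: power_mult_distrib times_divide_eq_right mult.left_commute)
qed

text \<open>The Poisson weights sum to one. Hence simultaneous rings and infinitely many rings
  before \<open>t\<close> are excluded at the same time.\<close>

lemma AE_word:
  assumes "0 < t"
  shows "AE \<omega> in M. \<exists>w. set w \<subseteq> {..n} \<and> \<omega> \<in> word_set n t w"
proof -
  let ?U = "\<lambda>m. \<Union>w\<in>words n m. word_set n t w"
  have disj: "disjoint_family ?U"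
    unfolding disjoint_family_on_def
  proof (intro ballI impI equals0I)
    fix m m' \<omega> assume "m \<noteq> m'" "\<omega> \<in> ?U m \<inter> ?U m'"
    then obtain w w' where "w \<in> words n m" "w' \<in> words n m'" "\<omega> \<in> word_set n t w \<inter> word_set n t w'" by blast
    moreover from this \<open>m \<noteq> m'\<close> have "w \<noteq> w'" by (auto simp: words_def)
    ultimately show False using word_set_disjoint[of w n w' t] by (auto simp: words_def)
  qed
  have "(\<lambda>m. prob (?U m)) sums prob (\<Union>m. ?U m)"
    by (rule finite_measure_UNION[OF _ disj]) auto
  moreover have "(\<lambda>m. prob (?U m)) sums (exp (- (real (Suc n) * t)) * exp (real (Suc n) * t))"
    unfolding prob_words_union[OF assms] by (rule exp_sums)
  ultimately have "prob (\<Union>m. ?U m) = exp (- (real (Suc n) * t)) * exp (real (Suc n) * t)"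
    by (rule sums_unique2)
  then have "prob (\<Union>m. ?U m) = 1" by (simp only: exp_add[symmetric]) simp
  then have "AE \<omega> in M. \<omega> \<in> (\<Union>m. ?U m)"
    by (subst (asm) prob_eq_1) auto
  then show ?thesis by eventually_elim (auto simp: words_def)
qed

lemma expectation_words:
  assumes t: "0 < t" and V [measurable]: "V \<in> borel_measurable M"
    and h: "\<And>w. set w \<subseteq> {..n} \<Longrightarrow> \<bar>h w\<bar> \<le> C"
    and V_eq: "AE \<omega> in M. \<forall>w. set w \<subseteq> {..n} \<longrightarrow> \<omega> \<in> word_set n t w \<longrightarrow> V \<omega> = h w"
  shows "expectation V = exp (- (real (Suc n) * t)) * (\<Sum>m. (\<Sum>w\<in>words n m. h w) / fact m * t ^ m)"
proof -
  \<comment> \<open>The contribution of words shorter than \<open>K\<close>; at each sample with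
    word \<open>w\<close> it equals \<open>V\<close> as soon as \<open>K\<close> exceeds the length
    of \<open>w\<close>.\<close>
  define s where "s K \<omega> = (\<Sum>m<K. \<Sum>w\<in>words n m. h w * indicator (word_set n t w) \<omega>)" for K \<omega>
  have meas [measurable]: "s K \<in> borel_measurable M" for K unfolding s_def by measurable
  have val: "AE \<omega> in M. \<exists>w. set w \<subseteq> {..n} \<and> V \<omega> = h w \<and> (\<forall>K. s K \<omega> = (if length w < K then h w else 0))"
    using AE_word[OF t, of n] V_eq
  proof eventually_elim
    case (elim \<omega>)
    then obtain w where w: "set w \<subseteq> {..n}" "\<omega> \<in> word_set n t w" "V \<omega> = h w" by blast
    have ind: "indicator (word_set n t w') \<omega> = (if w' = w then 1 else 0 :: real)" if "w' \<in> words n m" for w' m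
      using word_set_disjoint[of w' n w t] w that by (auto simp: indicator_def words_def)
    have "(\<Sum>w'\<in>words n m. h w' * indicator (word_set n t w') \<omega>) = (if m = length w then h w else 0)" for m
    proof -
      have "(\<Sum>w'\<in>words n m. h w' * indicator (word_set n t w') \<omega>) = (\<Sum>w'\<in>words n m. if w' = w then h w' else 0)"
        by (intro sum.cong refl) (simp add: ind)
      also have "\<dots> = (if w \<in> words n m then h w else 0)" by (subst sum.delta) auto
      finally show ?thesis using w by (auto simp: words_def)
    qed
    then have "s K \<omega> = (if length w < K then h w else 0)" for K
      unfolding s_def by simp
    then show ?case using w by blast
  qed
  have "(\<lambda>K. expectation (s K)) \<longlonglongrightarrow> expectation V"
  proof (rule integral_dominated_convergence[where w = "\<lambda>_. C"])
    show "AE \<omega> in M. (\<lambda>K. s K \<omega>) \<longlonglongrightarrow> V \<omega>"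
      using val
    proof eventually_elim
      case (elim \<omega>)
      then obtain w where w: "V \<omega> = h w" "\<And>K. s K \<omega> = (if length w < K then h w else 0)" by blast
      have "\<forall>\<^sub>F K in sequentially. s K \<omega> = V \<omega>"
        using eventually_gt_at_top[of "length w"] by eventually_elim (simp add: w)
      then show ?case by (rule tendsto_eventually)
    qed
    show "AE \<omega> in M. norm (s K \<omega>) \<le> C" for K
      using val
    proof eventually_elim
      case (elim \<omega>)
      then obtain w where w: "set w \<subseteq> {..n}" "s K \<omega> = (if length w < K then h w else 0)" by blast
      then show ?case using h[of w] h[of "[]"] by auto
    qed
  qed auto
  moreover have "expectation (s K) = (\<Sum>m<K. exp (- (real (Suc n) * t)) * ((\<Sum>w\<in>words n m. h w) / fact m * t ^ m))" for K
  proof -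
    have "expectation (s K) = (\<Sum>m<K. \<Sum>w\<in>words n m. h w * prob (word_set n t w))"
    proof -
      have int: "integrable M (\<lambda>\<omega>. h w * indicator (word_set n t w) \<omega> :: real)" for w
        by (intro integrable_mult_right integrable_real_indicator) (auto simp: emeasure_eq_measure)
      have "expectation (\<lambda>\<omega>. h w * indicator (word_set n t w) \<omega>) = h w * prob (word_set n t w)" for w
        by simp
      then show ?thesis
        unfolding s_def
        by (simp only: Bochner_Integration.integral_sum Bochner_Integration.integrable_sum int)
    qed
    also have "\<dots> = (\<Sum>m<K. \<Sum>w\<in>words n m. h w * (exp (- (real (Suc n) * t)) * t ^ m / fact m))"
      using prob_word_set[OF _ t] by (intro sum.cong refl) (auto simp: words_def)
    also have "\<dots> = (\<Sum>m<K. exp (- (real (Suc n) * t)) * ((\<Sum>w\<in>words n m. h w) / fact m * t ^ m))"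
      by (intro sum.cong refl)
        (simp add: sum_distrib_left sum_distrib_right sum_divide_distrib mult_ac del: of_nat_Suc)
    finally show ?thesis .
  qed
  ultimately have "(\<lambda>m. exp (- (real (Suc n) * t)) * ((\<Sum>w\<in>words n m. h w) / fact m * t ^ m)) sums expectation V"
    by (simp add: sums_def)
  from sums_mult_D[OF this] show ?thesis
    by (simp add: sums_iff del: of_nat_Suc)
qed

end

section \<open>Trajectories as functions of the ring order\<close>

text \<open>Replacing position \<open>k\<close> by its minimum with \<open>b - k\<close> turns the TASEP into the TASEP with a wall at \<open>b + 1\<close>.\<close>

definition capped :: "(nat \<Rightarrow> real \<Rightarrow> int) \<Rightarrow> int \<Rightarrow> nat \<Rightarrow> real \<Rightarrow> nat \<Rightarrow> int" where
  "capped \<xi> b n t k = (if k \<le> n then min (\<xi> k t) (b - int k) else step_init k)"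

text \<open>The pathwise properties of a typical sample. \<open>regular\<close> speaks of natural
  times only, so that it is a countable intersection of almost sure events;
  \<open>word_until_down\<close> recovers the other times.\<close>

locale clock_path =
  fixes x :: "nat \<times> nat \<Rightarrow> real" and \<xi> :: "nat \<Rightarrow> real \<Rightarrow> int"
  assumes pos: "\<And>p. 0 < x p"
    and path: "tasep_path (\<lambda>i. range (\<lambda>m. clock x i (Suc m))) step_init \<xi>"
    and regular: "\<And>n T :: nat. 0 < T \<Longrightarrow> \<exists>w. set w \<subseteq> {..n} \<and> word_event n w (real T) x"
begin

lemma clock_less: "m < m' \<Longrightarrow> clock x i m < clock x i m'"
  by (rule clock_strict_mono) (rule pos)

lemma constant_between_rings:
  assumes "0 \<le> a" "a \<le> c" "clock x k m \<le> a" "c < clock x k (Suc m)"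
  shows "\<xi> k c = \<xi> k a"
proof -
  have "clock x k (Suc l) \<notin> {a<..c}" for l
  proof (cases "l < m")
    case True
    then have "clock x k (Suc l) \<le> clock x k m"
      using clock_less[of "Suc l" m k] by (cases "Suc l = m") auto
    then show ?thesis using assms by auto
  next
    case False
    then have "clock x k (Suc m) \<le> clock x k (Suc l)"
      using clock_less[of "Suc m" "Suc l" k] by (cases "l = m") auto
    then show ?thesis using assms by auto
  qed
  then have "range (\<lambda>m. clock x k (Suc m)) \<inter> {a<..c} = {}" by blast
  then show ?thesis using path assms(1,2) unfolding tasep_path_def by blast
qed

lemma pos_before_eq:
  assumes "0 \<le> a" "a < s" "clock x k m \<le> a" "s \<le> clock x k (Suc m)"
  shows "pos_before \<xi> k s = \<xi> k a"
proof -
  have "\<forall>\<^sub>F c in at_left s. \<xi> k c = \<xi> k a"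
    using assms by (intro eventually_at_leftI[of a]) (auto intro!: constant_between_rings)
  then have "(\<xi> k \<longlongrightarrow> \<xi> k a) (at_left s)" by (rule tendsto_eventually)
  then show ?thesis unfolding pos_before_def by (intro tendsto_Lim) auto
qed

text \<open>The word of the rings strictly before \<open>s\<close>, where, unlike in
  \<open>word_event\<close>, \<open>s\<close> may itself be a ring time.\<close>

definition word_until :: "nat \<Rightarrow> nat list \<Rightarrow> real \<Rightarrow> bool" where
  "word_until n w s \<longleftrightarrow> chain x w s \<and> (\<forall>k\<le>n. s \<le> clock x k (Suc (count_list w k)))"

lemma word_until_left:
  assumes "word_until n w s"
  shows "\<exists>a. 0 < a \<and> a < s \<and> word_event n w a x \<and> (\<forall>k\<le>n. clock x k (count_list w k) \<le> a \<and> pos_before \<xi> k s = \<xi> k a)"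
proof -
  obtain a where a: "0 < a" "a < s" "chain x w a"
    using chain_left[of x w s] assms unfolding word_until_def by blast
  have "clock x k (count_list w k) \<le> a" for k
    using chain_clock_less[OF a(3)] by (rule less_imp_le)
  then show ?thesis
    using assms a by (intro exI[of _ a]) (auto simp: word_until_def word_event_def intro!: pos_before_eq)
qed

text \<open>Latest rings are removed from the word until the next one remaining precedes
  \<open>s\<close>.\<close>

lemma word_until_down:
  assumes "word_until n w r" "0 < s" "s \<le> r" "set w \<subseteq> {..n}"
  shows "\<exists>u. set u \<subseteq> {..n} \<and> word_until n u s"
  using assms
proof (induction w arbitrary: r)
  case Nil
  then show ?case by (intro exI[of _ "[]"]) (auto simp: word_until_def)
next
  case (Cons i w)
  let ?c = "clock x i (Suc (count_list w i))"
  show ?case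
  proof (cases "?c < s")
    case True
    with Cons.prems show ?thesis
      by (intro exI[of _ "i # w"]) (auto simp: word_until_def intro: order.trans)
  next
    case False
    have "word_until n w ?c"
      using Cons.prems(1) by (fastforce simp: word_until_def split: if_splits)
    then show ?thesis using Cons.IH[of ?c] Cons.prems False by auto
  qed
qed

lemma word_until_exists:
  assumes "0 < s"
  shows "\<exists>u. set u \<subseteq> {..n} \<and> word_until n u s"
proof -
  obtain T :: nat where T: "s \<le> real T" using real_arch_simple by blast
  then obtain w where "set w \<subseteq> {..n}" "word_event n w (real T) x"
    using regular[of T n] assms by auto
  then show ?thesis
    using T assms by (intro word_until_down[of n w "real T"]) (auto simp: word_until_def word_event_def less_imp_le)
qed

lemma word_event_Nil:
  assumes "word_event n [] t x" "k \<le> n"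
  shows "\<xi> k t = step_init k"
proof -
  have "\<xi> k t = \<xi> k 0"
    using assms by (intro constant_between_rings[of 0 t k 0]) (auto simp: word_event_def)
  then show ?thesis using path by (simp add: tasep_path_def)
qed

text \<open>The configuration just before the last ring is the one at some slightly earlier
  \<open>a\<close>, described by \<open>u\<close>, and nothing rings between \<open>s\<close> and
  \<open>t\<close>. The test for a blocker still ranges over all labels, since \<open>u\<close>
  controls only those up to \<open>n\<close>.\<close>

lemma last_ring:
  assumes "word_event n (i # u) t x" "i \<le> n"
  defines "s \<equiv> clock x i (Suc (count_list u i))"
  shows "\<exists>a. word_event n u a x \<and> (\<forall>k\<le>n. pos_before \<xi> k s = \<xi> k a) \<and> (\<forall>k\<le>n. k \<noteq> i \<longrightarrow> \<xi> k t = \<xi> k a)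
    \<and> \<xi> i t = (if \<exists>j. pos_before \<xi> j s = \<xi> i a + 1 then \<xi> i a else \<xi> i a + 1)"
proof -
  have st: "s < t" "chain x u s" and nxt: "\<And>k. k \<le> n \<Longrightarrow> t < clock x k (Suc (count_list (i # u) k))"
    using assms by (auto simp: word_event_def)
  have s0: "0 < s" using chain_pos[OF st(2)] .
  have "word_until n u s"
    unfolding word_until_def
  proof (intro conjI allI impI st)
    fix k assume "k \<le> n"
    then show "s \<le> clock x k (Suc (count_list u k))"
      using nxt[of k] st by (cases "k = i") (auto simp: s_def)
  qed
  then obtain a where a: "0 < a" "a < s" "word_event n u a x"
      "\<And>k. k \<le> n \<Longrightarrow> clock x k (count_list u k) \<le> a" "\<And>k. k \<le> n \<Longrightarrow> pos_before \<xi> k s = \<xi> k a"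
    using word_until_left by blast
  have "\<xi> k t = \<xi> k a" if "k \<le> n" "k \<noteq> i" for k
    using that a st nxt[of k] by (intro constant_between_rings[of a t k "count_list u k"]) auto
  moreover have "\<xi> i t = \<xi> i s"
    using assms(2) s0 st nxt[of i] by (intro constant_between_rings[of s t i "Suc (count_list u i)"]) (auto simp: s_def)
  moreover have "\<xi> i s = (if \<exists>j. pos_before \<xi> j s = pos_before \<xi> i s + 1 then pos_before \<xi> i s else pos_before \<xi> i s + 1)"
    using path unfolding tasep_path_def s_def by blast
  ultimately show ?thesis using a assms(2) by auto
qed

lemma word_event_ordered:
  assumes "word_event n w t x" "set w \<subseteq> {..n}" "k < n"
  shows "\<xi> (Suc k) t < \<xi> k t"
  using assms
proof (induction w arbitrary: t k)
  case Nil
  then show ?case using word_event_Nil[of n t] by (auto simp: step_init_def)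
next
  case (Cons i u)
  let ?s = "clock x i (Suc (count_list u i))"
  obtain a where a: "word_event n u a x" "\<And>k. k \<le> n \<Longrightarrow> pos_before \<xi> k ?s = \<xi> k a"
      "\<And>k. k \<le> n \<Longrightarrow> k \<noteq> i \<Longrightarrow> \<xi> k t = \<xi> k a"
      "\<xi> i t = (if \<exists>j. pos_before \<xi> j ?s = \<xi> i a + 1 then \<xi> i a else \<xi> i a + 1)"
    using last_ring[OF Cons.prems(1)] Cons.prems(2) by auto
  have o: "\<xi> (Suc k) a < \<xi> k a" using Cons.IH[OF a(1)] Cons.prems by simp
  consider "i = Suc k" | "i = k" | "i \<noteq> k" "i \<noteq> Suc k" by blast
  then show ?case
  proof cases
    case 1
    have "\<xi> (Suc k) t \<le> \<xi> (Suc k) a + 1" using a(4) 1 by auto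
    moreover have "\<xi> (Suc k) t = \<xi> (Suc k) a" if "\<xi> k a = \<xi> (Suc k) a + 1"
      using a(2)[of k] a(4) 1 Cons.prems(3) that by auto
    moreover have "\<xi> k t = \<xi> k a" using a(3)[of k] 1 Cons.prems(3) by auto
    ultimately show ?thesis using o by linarith
  next
    case 2
    then have "\<xi> k a \<le> \<xi> k t" using a(4) by auto
    then show ?thesis using o a(3)[of "Suc k"] 2 Cons.prems(3) by auto
  next
    case 3
    then show ?thesis using o a(3)[of k] a(3)[of "Suc k"] Cons.prems(3) by auto
  qed
qed

text \<open>Larger words, on \<open>{..Suc k}\<close> for each \<open>k\<close>, extend the order to
  all labels; so no particle far behind can act as a blocker.\<close>

lemma pos_before_less:
  assumes "0 < s" "k < j"
  shows "pos_before \<xi> j s < pos_before \<xi> k s"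
proof -
  have "pos_before \<xi> (Suc k) s < pos_before \<xi> k s" for k
  proof -
    obtain u where u: "set u \<subseteq> {..Suc k}" "word_until (Suc k) u s" using word_until_exists[OF assms(1)] by blast
    obtain a where a: "word_event (Suc k) u a x" "\<And>l. l \<le> Suc k \<Longrightarrow> pos_before \<xi> l s = \<xi> l a"
      using word_until_left[OF u(2)] by blast
    then show ?thesis using word_event_ordered[OF a(1) u(1), of k] by simp
  qed
  then show ?thesis
    using lift_Suc_mono_less[of "\<lambda>k. - pos_before \<xi> k s", OF _ assms(2)] by simp
qed

text \<open>A particle below its cap is blocked in the capped configuration exactly when it is
  blocked in the true one. If particle \<open>i\<close> has reached its cap, the order forces
  particle \<open>i - 1\<close> to have reached its own, one site ahead, so the capped jump is
  blocked as well; for \<open>i = 0\<close> the wall blocks it.\<close>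

lemma capped_eq_run:
  assumes "word_event n w t x" "set w \<subseteq> {..n}" "- 1 \<le> b"
  shows "capped \<xi> b n t = run b w"
  using assms
proof (induction w arbitrary: t)
  case Nil
  then show ?case using word_event_Nil[OF Nil(1)] by (auto simp: capped_def step_init_def fun_eq_iff)
next
  case (Cons i u)
  let ?s = "clock x i (Suc (count_list u i))"
  have i: "i \<le> n" using Cons.prems(2) by simp
  obtain a where a: "word_event n u a x" "\<And>k. k \<le> n \<Longrightarrow> pos_before \<xi> k ?s = \<xi> k a"
      "\<And>k. k \<le> n \<Longrightarrow> k \<noteq> i \<Longrightarrow> \<xi> k t = \<xi> k a"
      "\<xi> i t = (if \<exists>j. pos_before \<xi> j ?s = \<xi> i a + 1 then \<xi> i a else \<xi> i a + 1)"
    using last_ring[OF Cons.prems(1) i] by blast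
  have s0: "0 < ?s" using Cons.prems(1) by (auto simp: word_event_def intro: chain_pos)
  \<comment> \<open>By strict order the site next to particle \<open>i\<close> can only be held by
    particle \<open>i - 1\<close>.\<close>
  have blocked: "(\<exists>j. pos_before \<xi> j ?s = \<xi> i a + 1) \<longleftrightarrow> (\<exists>j. i = Suc j \<and> \<xi> j a = \<xi> i a + 1)"
  proof
    assume "\<exists>j. pos_before \<xi> j ?s = \<xi> i a + 1"
    then obtain j where j: "pos_before \<xi> j ?s = \<xi> i a + 1" by blast
    have ia: "pos_before \<xi> i ?s = \<xi> i a" by (rule a(2)[OF i])
    have ji: "j < i"
      using pos_before_less[OF s0, of i j] j ia by (cases i j rule: linorder_cases) auto
    then obtain l where l: "i = Suc l" by (cases i) auto
    have "j = l"
    proof (rule ccontr)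
      assume "j \<noteq> l"
      then have "j < l" using ji l by simp
      then show False using pos_before_less[OF s0, of j l] pos_before_less[OF s0, of l i] j ia l by simp
    qed
    then show "\<exists>j. i = Suc j \<and> \<xi> j a = \<xi> i a + 1" using l j a(2)[of l] i by simp
  next
    assume "\<exists>j. i = Suc j \<and> \<xi> j a = \<xi> i a + 1"
    then show "\<exists>j. pos_before \<xi> j ?s = \<xi> i a + 1" using a(2) i by (metis Suc_leD)
  qed
  have "capped \<xi> b n t = jump b i (capped \<xi> b n a)"
  proof (rule ext)
    fix k
    show "capped \<xi> b n t k = jump b i (capped \<xi> b n a) k"
    proof (cases "k = i")
      case False
      then show ?thesis using a(3)[of k] by (simp add: capped_def jump_def)
    next
      case k: True
      show ?thesis
      proof (cases i)
        case 0
        then show ?thesis using k a(4) blocked by (auto simp: capped_def jump_def ahead_def)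
      next
        case (Suc j)
        have "\<xi> i a < \<xi> j a"
          using word_event_ordered[OF a(1), of j] Cons.prems(2) i Suc by auto
        moreover have "\<xi> i t = (if \<xi> j a = \<xi> i a + 1 then \<xi> i a else \<xi> i a + 1)"
          using a(4) blocked Suc by simp
        ultimately show ?thesis using k i Suc
          by (auto simp: capped_def jump_def ahead_def min_def split: if_splits)
      qed
    qed
  qed
  also have "capped \<xi> b n a = run b u" using Cons.IH[OF a(1)] Cons.prems by simp
  finally show ?case by simp
qed

end

lemma mean_nonneg:
  assumes "bounded_by b n C F" "\<And>w. 0 \<le> F (run b w)" "0 \<le> t"
  shows "0 \<le> mean b n F t"
proof -
  have "0 \<le> moment b n F m" for m
    unfolding moment_def by (intro sum_nonneg assms(2))
  then show ?thesis
    unfolding mean_def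
    by (intro mult_nonneg_nonneg suminf_nonneg summable_moment[OF assms(1)] divide_nonneg_nonneg
        zero_le_power assms(3)) auto
qed

section \<open>Crossing the origin\<close>

definition passed :: "nat \<Rightarrow> (nat \<Rightarrow> int) \<Rightarrow> real" where
  "passed k y = (if 0 \<le> y k then 1 else 0)"

text \<open>For \<open>k = 0\<close>, \<open>ahead (int k) y k\<close> is the wall at site
  \<open>1\<close>, so the second condition then always holds.\<close>

definition crossing :: "nat \<Rightarrow> (nat \<Rightarrow> int) \<Rightarrow> real" where
  "crossing k y = (if y k = - 1 \<and> ahead (int k) y k \<noteq> 0 then 1 else 0)"

text \<open>\<open>Suc k\<close> is the last particle because \<open>mean_bwd\<close> needs a
  function that ignores the last one, while the gap behind particle \<open>k\<close> must still be
  visible.\<close>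

lemma fwd_passed: "fwd (int k) (Suc k) (passed k) = crossing k"
proof
  fix y
  have "passed k (jump (int k) j y) - passed k y = (if j = k then crossing k y else 0)" for j
    by (auto simp: passed_def jump_def crossing_def)
  then show "fwd (int k) (Suc k) (passed k) y = crossing k y"
    by (simp add: fwd_def)
qed

text \<open>Only pulls of particle \<open>k\<close> to a negative site undo the event.
  \<open>nat\<close> gives \<open>0\<close> when particle \<open>Suc k\<close> has passed as well,
  so the value is nonzero only if exactly \<open>k + 1\<close> particles have passed, and the rate
  \<open>k + 1\<close> becomes the factor \<open>N\<close>.\<close>

lemma bwd_passed: "bwd (Suc k) (passed k) y = - (real (Suc k) * (if 0 \<le> y k then real (nat (- 1 - y (Suc k))) else 0))"
proof -
  have "pull j (passed k) y = 0" if "j < k" for j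
    using that by (simp add: pull_def passed_def)
  moreover have "pull k (passed k) y = - (if 0 \<le> y k then real (nat (- 1 - y (Suc k))) else 0)"
  proof (cases "0 \<le> y k")
    case True
    have "pull k (passed k) y = (\<Sum>z\<in>{y (Suc k)<..<y k}. if z < 0 then - 1 else 0)"
      using True by (auto simp: pull_def passed_def intro!: sum.cong)
    also have "\<dots> = (\<Sum>z\<in>{y (Suc k)<..<0}. - 1)"
      using True by (intro sum.mono_neutral_cong_right) auto
    finally show ?thesis using True by simp
  next
    case False
    then show ?thesis by (simp add: pull_def passed_def)
  qed
  ultimately show ?thesis by (simp add: bwd_def)
qed

text \<open>Only a jump of particle \<open>k\<close> itself destroys the crossing configuration: the
  particle ahead, being beyond \<open>0\<close>, can only move further away. So the loss rate is at
  most one.\<close>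

lemma fwd_crossing_ge:
  assumes "ordered (int k) (Suc k) y"
  shows "- crossing k y \<le> fwd (int k) (Suc k) (crossing k) y"
proof -
  have "(if j = k then - crossing k y else 0) \<le> crossing k (jump (int k) j y) - crossing k y" for j
  proof (cases "j = k \<or> crossing k y = 0")
    case True
    then show ?thesis by (auto simp: crossing_def)
  next
    case False
    then have "y k = - 1" "ahead (int k) y k \<noteq> 0" by (auto simp: crossing_def split: if_splits)
    moreover have "y k < ahead (int k) y k" using assms by (auto simp: ordered_def)
    ultimately have "crossing k (jump (int k) j y) = 1"
      using False by (cases k) (auto simp: crossing_def jump_def ahead_def)
    then show ?thesis using False by (auto simp: crossing_def)
  qed
  then have "(\<Sum>j\<le>Suc k. if j = k then - crossing k y else 0) \<le> fwd (int k) (Suc k) (crossing k) y"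
    unfolding fwd_def by (rule sum_mono)
  then show ?thesis by simp
qed

lemma bounded_by_crossing: "bounded_by b n 1 (crossing k)"
  by (auto simp: bounded_by_def crossing_def)

lemma bounded_by_passed: "bounded_by b n 1 (passed k)"
  by (auto simp: bounded_by_def passed_def)

lemma mean_passed_DERIV:
  "(mean (int k) (Suc k) (passed k) has_real_derivative mean (int k) (Suc k) (crossing k) t) (at t)"
  using has_derivative_mean[OF bounded_by_passed, of "int k" "Suc k" k t] by (simp only: fwd_passed)

lemma mean_crossing_DERIV:
  assumes "0 \<le> t"
  shows "\<exists>D. (mean (int k) (Suc k) (crossing k) has_real_derivative D) (at t) \<and> - mean (int k) (Suc k) (crossing k) t \<le> D"
proof (intro exI conjI)
  let ?g = "crossing k" and ?A = "fwd (int k) (Suc k) (crossing k)"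
  show "(mean (int k) (Suc k) ?g has_real_derivative mean (int k) (Suc k) ?A t) (at t)"
    by (rule has_derivative_mean[OF bounded_by_crossing])
  have "\<bar>?g y\<bar> \<le> 1" for y by (simp add: crossing_def)
  then have A: "\<bar>?A y\<bar> \<le> 2 * real (Suc (Suc k)) * 1" for y by (rule abs_fwd_le)
  then have A': "bounded_by (int k) (Suc k) (2 * real (Suc (Suc k)) * 1) ?A" by (simp add: bounded_by_def)
  have "0 \<le> mean (int k) (Suc k) (\<lambda>y. ?A y + ?g y) t"
  proof (rule mean_nonneg)
    show "bounded_by (int k) (Suc k) (2 * real (Suc (Suc k)) * 1 + 1) (\<lambda>y. ?A y + ?g y)"
      unfolding bounded_by_def
    proof (intro allI impI)
      fix w
      show "\<bar>?A (run (int k) w) + ?g (run (int k) w)\<bar> \<le> 2 * real (Suc (Suc k)) * 1 + 1"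
        using A[of "run (int k) w"] by (auto simp: crossing_def)
    qed
    show "0 \<le> ?A (run (int k) w) + ?g (run (int k) w)" for w
      using fwd_crossing_ge[OF ordered_run[of "int k" "Suc k" w]] by simp
  qed (rule assms)
  also have "\<dots> = mean (int k) (Suc k) ?A t + mean (int k) (Suc k) ?g t"
    by (rule mean_add[OF A' bounded_by_crossing])
  finally show "- mean (int k) (Suc k) ?g t \<le> mean (int k) (Suc k) ?A t" by simp
qed

lemma mean_bwd_passed:
  "mean (int k) (Suc k) (bwd (Suc k) (passed k)) t = - (t * mean (int k) (Suc k) (crossing k) t)"
proof -
  have "mean (int k) (Suc k) (bwd (Suc k) (passed k)) t + t * mean (int k) (Suc k) (fwd (int k) (Suc k) (passed k)) t = 0"
    by (rule mean_bwd[where C = 1]) (auto simp: passed_def)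
  then show ?thesis unfolding fwd_passed by simp
qed

section \<open>From ring orders to the probability space\<close>

locale step_tasep = tasep M step_init W X
  for M :: "'w measure" and W :: "nat \<Rightarrow> nat \<Rightarrow> 'w \<Rightarrow> real" and X :: "nat \<Rightarrow> real \<Rightarrow> 'w \<Rightarrow> int"
begin

sublocale exp_clocks M "\<lambda>(i, n). W i n"
  by unfold_locales (use indep_waiting exp_waiting in auto)

abbreviation waits :: "'w \<Rightarrow> nat \<times> nat \<Rightarrow> real" where
  "waits \<omega> \<equiv> \<lambda>p. (case p of (i, n) \<Rightarrow> W i n) \<omega>"

abbreviation traj :: "'w \<Rightarrow> nat \<Rightarrow> real \<Rightarrow> int" where
  "traj \<omega> \<equiv> \<lambda>i t. X i t \<omega>"

lemma AE_clock_path: "AE \<omega> in M. clock_path (waits \<omega>) (traj \<omega>)"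
proof -
  have "AE \<omega> in M. \<forall>n. \<forall>T :: nat. 0 < T \<longrightarrow> (\<exists>w. set w \<subseteq> {..n} \<and> word_event n w (real T) (waits \<omega>))"
    unfolding AE_all_countable
  proof (intro allI)
    fix n T :: nat
    show "AE \<omega> in M. 0 < T \<longrightarrow> (\<exists>w. set w \<subseteq> {..n} \<and> word_event n w (real T) (waits \<omega>))"
    proof (cases "0 < T")
      case True
      then have "AE \<omega> in M. \<exists>w. set w \<subseteq> {..n} \<and> \<omega> \<in> word_set n (real T) w" by (intro AE_word) simp
      then show ?thesis by eventually_elim (auto simp: word_set_def)
    qed simp
  qed
  then show ?thesis
    using AE_pos path
  proof eventually_elim
    case (elim \<omega>)
    have "range (\<lambda>n. ring_time W i n \<omega>) = range (\<lambda>m. clock (waits \<omega>) i (Suc m))" for i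
      by (simp add: ring_time_def clock_def lessThan_Suc_atMost)
    then show ?case using elim by unfold_locales auto
  qed
qed

lemma AE_capped_run:
  assumes "0 < t"
  shows "AE \<omega> in M. clock_path (waits \<omega>) (traj \<omega>) \<and> (\<exists>w. set w \<subseteq> {..n} \<and> word_event n w t (waits \<omega>))"
  using AE_word[OF assms, of n] AE_clock_path
  by eventually_elim (auto simp: word_set_def)

lemma expectation_capped:
  assumes t: "0 < t" and b: "- 1 \<le> b" and F: "bounded_by b n C F"
    and V [measurable]: "V \<in> borel_measurable M" and eq: "\<And>\<omega>. V \<omega> = F (capped (traj \<omega>) b n t)"
  shows "integrable M V" "expectation V = mean b n F t"
proof -
  show "integrable M V"
  proof (rule integrable_const_bound[where B = C])
    show "AE \<omega> in M. norm (V \<omega>) \<le> C"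
      using AE_capped_run[OF t, of n]
    proof eventually_elim
      case (elim \<omega>)
      then obtain w where "set w \<subseteq> {..n}" "word_event n w t (waits \<omega>)" "clock_path (waits \<omega>) (traj \<omega>)" by blast
      then show ?case using F clock_path.capped_eq_run b by (auto simp: eq bounded_by_def)
    qed
  qed (rule V)
  have "expectation V = exp (- (real (Suc n) * t)) * (\<Sum>m. (\<Sum>w\<in>words n m. F (run b w)) / fact m * t ^ m)"
  proof (rule expectation_words[OF t V])
    show "\<bar>F (run b w)\<bar> \<le> C" if "set w \<subseteq> {..n}" for w using F that by (simp add: bounded_by_def)
    show "AE \<omega> in M. \<forall>w. set w \<subseteq> {..n} \<longrightarrow> \<omega> \<in> word_set n t w \<longrightarrow> V \<omega> = F (run b w)"
      using AE_clock_path
      by eventually_elim (auto simp: word_set_def eq clock_path.capped_eq_run b)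
  qed
  then show "expectation V = mean b n F t" by (simp add: mean_def moment_def)
qed

end

section \<open>The observables\<close>

text \<open>In the discrete topology a convergent net of finite sums is eventually constant, which
  forces finite support. Otherwise \<open>infsum\<close> takes its default value
  \<open>0\<close>.\<close>

lemma infsum_nat_infinite_support:
  fixes f :: "'a \<Rightarrow> nat"
  assumes "infinite {x \<in> A. f x \<noteq> 0}"
  shows "infsum f A = 0"
proof (rule infsum_not_exists)
  show "\<not> f summable_on A"
  proof
    assume "f summable_on A"
    then obtain l where "(f has_sum l) A" by (auto simp: summable_on_def)
    then have "\<forall>\<^sub>F F in finite_subsets_at_top A. sum f F = l"
      by (simp add: has_sum_def tendsto_discrete)
    then obtain F where F: "finite F" "F \<subseteq> A" "\<And>F'. finite F' \<Longrightarrow> F \<subseteq> F' \<Longrightarrow> F' \<subseteq> A \<Longrightarrow> sum f F' = l"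
      by (auto simp: eventually_finite_subsets_at_top)
    have "{x \<in> A. f x \<noteq> 0} \<subseteq> F"
    proof
      fix x assume x: "x \<in> {x \<in> A. f x \<noteq> 0}"
      show "x \<in> F"
      proof (rule ccontr)
        assume "x \<notin> F"
        then show False using F(3)[of "insert x F"] F(3)[of F] F(1,2) x by auto
      qed
    qed
    then show False using assms F(1) finite_subset by blast
  qed
qed

lemma N0_finite:
  assumes "\<And>x. K \<le> x \<Longrightarrow> occupation X t (int x) \<omega> = 0"
  shows "N0 X t \<omega> = (\<Sum>x<K. occupation X t (int x) \<omega>)"
proof -
  have "N0 X t \<omega> = infsum (\<lambda>x. occupation X t x \<omega>) (int ` {..<K})"
    unfolding N0_def
  proof (rule infsum_cong_neutral)
    fix x assume "x \<in> {0..} - int ` {..<K}"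
    then have "0 \<le> x" "K \<le> nat x" by (auto simp: image_iff) (metis lessThan_iff not_le nat_0_le)
    then show "occupation X t x \<omega> = 0" using assms[of "nat x"] by simp
  qed auto
  then show ?thesis by (simp add: sum.reindex)
qed

lemma N0_infinite:
  assumes "\<nexists>K. \<forall>x\<ge>K. occupation X t (int x) \<omega> = 0"
  shows "N0 X t \<omega> = 0"
  unfolding N0_def
proof (rule infsum_nat_infinite_support)
  show "infinite {x \<in> {0..}. occupation X t x \<omega> \<noteq> 0}"
  proof
    assume "finite {x \<in> {0..}. occupation X t x \<omega> \<noteq> 0}"
    then obtain K where K: "\<forall>x\<in>{x \<in> {0..}. occupation X t x \<omega> \<noteq> 0}. x \<le> K"
      by (meson bdd_above_def bdd_above_finite)
    have "occupation X t (int x) \<omega> = 0" if "nat (K + 1) \<le> x" for x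
    proof -
      have "\<not> int x \<le> K" using that by linarith
      then have "int x \<notin> {x \<in> {0..}. occupation X t x \<omega> \<noteq> 0}" using K by blast
      then show ?thesis by simp
    qed
    then show False using assms by blast
  qed
qed

lemma gap_term_nonzero:
  assumes "gap_term X t x \<omega> \<noteq> 0" "1 \<le> x"
  shows "occupation X t (- int x - 1) \<omega> = 1" "\<And>k. 1 \<le> k \<Longrightarrow> k \<le> x \<Longrightarrow> occupation X t (- int k) \<omega> = 0"
proof -
  have p: "occupation X t (- int x - 1) \<omega> \<noteq> 0" "(\<Prod>k=1..x. 1 - real (occupation X t (- int k) \<omega>)) \<noteq> 0"
    using assms by (auto simp: gap_term_def)
  show "occupation X t (- int x - 1) \<omega> = 1" using p(1) by (auto simp: occupation_def split: if_splits)
  show "occupation X t (- int k) \<omega> = 0" if "1 \<le> k" "k \<le> x" for k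
    using p(2) that by (auto simp: occupation_def split: if_splits)
qed

text \<open>A nonzero term at \<open>x\<close> says that the rightmost particle left of the origin
  sits at \<open>- x - 1\<close>. This holds for every sample.\<close>

lemma gap_term_unique:
  assumes "gap_term X t x \<omega> \<noteq> 0" "gap_term X t y \<omega> \<noteq> 0" "1 \<le> x" "1 \<le> y"
  shows "x = y"
proof -
  have "\<not> x < y" if "gap_term X t x \<omega> \<noteq> 0" "gap_term X t y \<omega> \<noteq> 0" "1 \<le> x" "1 \<le> y" for x y
  proof
    assume "x < y"
    then have "occupation X t (- int (Suc x)) \<omega> = 0"
      by (intro gap_term_nonzero(2)[OF that(2,4)]) auto
    moreover have "- int (Suc x) = - int x - 1" by simp
    ultimately show False using gap_term_nonzero(1)[OF that(1,3)] by (metis zero_neq_one)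
  qed
  then show ?thesis using assms by (meson linorder_neqE_nat)
qed

lemma gap_sum_eq:
  assumes "\<And>x. 1 \<le> x \<Longrightarrow> x \<noteq> y \<Longrightarrow> gap_term X t x \<omega> = 0" "1 \<le> y"
  shows "gap_sum X t \<omega> = gap_term X t y \<omega>"
proof -
  have "gap_sum X t \<omega> = infsum (\<lambda>x. gap_term X t x \<omega>) {y}"
    unfolding gap_sum_def by (rule infsum_cong_neutral) (use assms in auto)
  then show ?thesis by simp
qed

lemma gap_sum_LIMSEQ: "(\<lambda>K. \<Sum>x=1..K. gap_term X t x \<omega>) \<longlonglongrightarrow> gap_sum X t \<omega>"
proof -
  obtain y where y: "1 \<le> y" "\<And>x. 1 \<le> x \<Longrightarrow> x \<noteq> y \<Longrightarrow> gap_term X t x \<omega> = 0"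
    using gap_term_unique[of X t _ \<omega>] by (metis le_refl)
  have "\<forall>\<^sub>F K in sequentially. (\<Sum>x=1..K. gap_term X t x \<omega>) = gap_sum X t \<omega>"
    using eventually_ge_at_top[of y]
  proof eventually_elim
    case (elim K)
    have "(\<Sum>x=1..K. gap_term X t x \<omega>) = (\<Sum>x\<in>{y}. gap_term X t x \<omega>)"
      using y elim by (intro sum.mono_neutral_right) auto
    then show ?case using gap_sum_eq[of y X t \<omega>] y by simp
  qed
  then show ?thesis by (rule tendsto_eventually)
qed

text \<open>\<open>m\<close> is the label of the first particle left of the origin; the particles
  ahead of it are exactly those counted.\<close>

lemma configuration:
  fixes X :: "nat \<Rightarrow> real \<Rightarrow> 'w \<Rightarrow> int"
  assumes dec: "\<And>k. X (Suc k) t \<omega> < X k t \<omega>" and m: "X m t \<omega> < 0" "\<And>k. k < m \<Longrightarrow> 0 \<le> X k t \<omega>"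
  shows "N0 X t \<omega> = m"
    and "occupation X t (X m t \<omega>) \<omega> = 1"
    and "\<And>y. X m t \<omega> < y \<Longrightarrow> y < 0 \<Longrightarrow> occupation X t y \<omega> = 0"
    and "gap_sum X t \<omega> = real (nat (- 1 - X m t \<omega>))"
proof -
  have less: "X j t \<omega> < X i t \<omega>" if "i < j" for i j
    using lift_Suc_mono_less[of "\<lambda>k. - X k t \<omega>", OF _ that] dec by simp
  have inj: "inj_on (\<lambda>k. X k t \<omega>) {..<m}"
    by (intro linorder_inj_onI) (use less in fastforce)+
  have occ: "occupation X t x \<omega> = (if x \<in> (\<lambda>k. X k t \<omega>) ` {..<m} then 1 else 0)" if "0 \<le> x" for x
  proof -
    have "k < m" if "X k t \<omega> = x" for k
      using less[of m k] m(1) \<open>0 \<le> x\<close> that by (cases k m rule: linorder_cases) auto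
    then show ?thesis by (auto simp: occupation_def)
  qed
  have "N0 X t \<omega> = infsum (\<lambda>x. occupation X t x \<omega>) ((\<lambda>k. X k t \<omega>) ` {..<m})"
    unfolding N0_def by (rule infsum_cong_neutral) (use occ m(2) in auto)
  also have "\<dots> = (\<Sum>k<m. occupation X t (X k t \<omega>) \<omega>)"
    by (simp add: sum.reindex[OF inj])
  also have "\<dots> = (\<Sum>k<m. 1)" by (intro sum.cong refl) (auto simp: occupation_def)
  finally show "N0 X t \<omega> = m" by simp
  show r: "occupation X t (X m t \<omega>) \<omega> = 1" by (auto simp: occupation_def)
  show e: "occupation X t y \<omega> = 0" if y: "X m t \<omega> < y" "y < 0" for y
  proof -
    have "X k t \<omega> \<noteq> y" for k
      using less[of m k] m(2)[of k] y by (cases k m rule: linorder_cases) auto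
    then show ?thesis by (auto simp: occupation_def)
  qed
  let ?d = "nat (- 1 - X m t \<omega>)"
  have other: "gap_term X t x \<omega> = 0" if "1 \<le> x" "x \<noteq> ?d" for x
  proof (rule ccontr)
    assume nz: "gap_term X t x \<omega> \<noteq> 0"
    note g = gap_term_nonzero[OF nz that(1)]
    have "int x \<noteq> - 1 - X m t \<omega>" using that(2) by auto
    then consider "int x < - 1 - X m t \<omega>" | "- 1 - X m t \<omega> < int x" by (meson linorder_neqE)
    then show False
    proof cases
      case 1
      then show False using g(1) e[of "- int x - 1"] by simp
    next
      case 2
      then have "nat (- X m t \<omega>) \<le> x" "1 \<le> nat (- X m t \<omega>)" "- int (nat (- X m t \<omega>)) = X m t \<omega>"
        using m(1) by auto
      then show False using g(2)[of "nat (- X m t \<omega>)"] r by simp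
    qed
  qed
  show "gap_sum X t \<omega> = real ?d"
  proof (cases "1 \<le> ?d")
    case True
    have "- int ?d - 1 = X m t \<omega>" using m(1) True by simp
    moreover have "(\<Prod>k=1..?d. 1 - real (occupation X t (- int k) \<omega>)) = (\<Prod>k=1..?d. 1)"
      using e by (intro prod.cong refl) auto
    ultimately have "gap_term X t ?d \<omega> = real ?d" using r by (simp add: gap_term_def)
    then show ?thesis using gap_sum_eq[OF other True] by simp
  next
    case False
    \<comment> \<open>Particle \<open>m\<close> sits at \<open>-1\<close>, so all terms vanish;
      \<open>1\<close> is an arbitrary index for \<open>gap_sum_eq\<close>.\<close>
    then have "gap_sum X t \<omega> = gap_term X t 1 \<omega>" using other by (intro gap_sum_eq) auto
    then show ?thesis using other[of 1] False by simp
  qed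
qed

context step_tasep
begin

lemma measurable_occupation [measurable]:
  assumes "0 \<le> t"
  shows "occupation X t x \<in> measurable M (count_space UNIV)"
proof -
  note [measurable] = measurable_pos[OF assms]
  show ?thesis unfolding occupation_def[abs_def] by measurable
qed

lemma measurable_N0:
  assumes "0 \<le> t"
  shows "N0 X t \<in> measurable M (count_space UNIV)"
proof -
  note [measurable] = measurable_occupation[OF assms]
  let ?fin = "\<lambda>K \<omega>. \<forall>x. K \<le> x \<longrightarrow> occupation X t (int x) \<omega> = 0"
  \<comment> \<open>A countable description of the level sets, including the default value
    \<open>0\<close> for infinitely many occupied sites.\<close>
  have eq: "N0 X t \<omega> = m \<longleftrightarrow> (\<exists>K. ?fin K \<omega> \<and> (\<Sum>x<K. occupation X t (int x) \<omega>) = m) \<or> (m = 0 \<and> \<not> (\<exists>K. ?fin K \<omega>))" for m \<omega>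
    using N0_finite[of _ X t \<omega>] N0_infinite[of X t \<omega>] by metis
  have "Measurable.pred M (\<lambda>\<omega>. N0 X t \<omega> = m)" for m
    unfolding eq by measurable
  then show ?thesis
    by (intro measurable_count_space_eq2_countable[THEN iffD2]) (auto simp: pred_def vimage_def Int_def conj_commute)
qed

lemma measurable_gap_sum:
  assumes "0 \<le> t"
  shows "gap_sum X t \<in> borel_measurable M"
proof (rule borel_measurable_LIMSEQ_real)
  note [measurable] = measurable_occupation[OF assms]
  show "(\<lambda>\<omega>. \<Sum>x=1..K. gap_term X t x \<omega>) \<in> borel_measurable M" for K
    unfolding gap_term_def by measurable
qed (rule gap_sum_LIMSEQ)

text \<open>Almost surely some clock has not rung by time \<open>t\<close>, since the first
  \<open>K + 1\<close> independent clocks all ring with probability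
  \<open>(1 - exp (- t)) ^ (K + 1)\<close>. The particle of a silent clock is still at its negative
  initial site.\<close>

lemma AE_particle_behind:
  assumes "0 < t"
  shows "AE \<omega> in M. \<exists>k. X k t \<omega> < 0"
proof -
  let ?A = "\<lambda>k. {\<omega> \<in> space M. W k 0 \<omega> \<le> t}"
  have rv [measurable]: "W k 0 \<in> borel_measurable M" for k
    using random_variable_Z[of "(k, 0)"] by simp
  have pA: "prob (?A k) = 1 - exp (- t)" for k
    using exponential_distributedD_le[OF exp_waiting[of k 0], of t] assms by simp
  have fin: "prob (\<Inter>k\<in>{..K}. ?A k) = (1 - exp (- t)) ^ Suc K" for K
  proof -
    have "prob (\<Inter>p\<in>(\<lambda>k. (k, 0)) ` {..K}. (case p of (i, n) \<Rightarrow> W i n) -` {..t} \<inter> space M)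
        = (\<Prod>p\<in>(\<lambda>k. (k, 0)) ` {..K}. prob ((case p of (i, n) \<Rightarrow> W i n) -` {..t} \<inter> space M))"
      by (rule indep_varsD[OF indep_waiting]) auto
    moreover have "(\<Inter>k\<in>{..K}. ?A k)
        = (\<Inter>p\<in>(\<lambda>k. (k, 0)) ` {..K}. (case p of (i, n) \<Rightarrow> W i n) -` {..t} \<inter> space M)"
      by auto
    moreover have "W k 0 -` {..t} \<inter> space M = ?A k" for k by auto
    ultimately show ?thesis by (simp add: prod.reindex inj_on_def pA del: INT_simps)
  qed
  have "prob (\<Inter>k. ?A k) \<le> (1 - exp (- t)) ^ Suc K" for K
    unfolding fin[symmetric] by (intro finite_measure_mono) auto
  moreover have "(\<lambda>K. (1 - exp (- t)) ^ Suc K) \<longlonglongrightarrow> 0"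
    using assms by (intro LIMSEQ_Suc LIMSEQ_realpow_zero) auto
  ultimately have "prob (\<Inter>k. ?A k) \<le> 0"
    by (intro LIMSEQ_le_const) auto
  then have "(\<Inter>k. ?A k) \<in> null_sets M"
    by (intro null_setsI) (auto simp: emeasure_eq_measure measure_le_0_iff)
  then have "AE \<omega> in M. \<omega> \<notin> (\<Inter>k. ?A k)" by (rule AE_not_in)
  then show ?thesis
    using AE_clock_path AE_space
  proof eventually_elim
    case (elim \<omega>)
    then obtain k where k: "t < W k 0 \<omega>" by (auto simp: not_le)
    interpret clock_path "waits \<omega>" "traj \<omega>" by (rule elim)
    have "X k t \<omega> = X k 0 \<omega>"
      using k assms by (intro constant_between_rings[of 0 t k 0]) (auto simp: clock_def)
    then show ?case using path by (intro exI[of _ k]) (auto simp: tasep_path_def step_init_def)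
  qed
qed

lemma AE_configuration:
  assumes "0 < t"
  shows "AE \<omega> in M. (\<forall>k. X (Suc k) t \<omega> < X k t \<omega>) \<and> (\<exists>m. X m t \<omega> < 0 \<and> (\<forall>k<m. 0 \<le> X k t \<omega>))"
proof -
  have "AE \<omega> in M. \<forall>n. clock_path (waits \<omega>) (traj \<omega>) \<and> (\<exists>w. set w \<subseteq> {..n} \<and> word_event n w t (waits \<omega>))"
    unfolding AE_all_countable using AE_capped_run[OF assms] by blast
  then show ?thesis
    using AE_particle_behind[OF assms]
  proof eventually_elim
    case (elim \<omega>)
    have "X (Suc k) t \<omega> < X k t \<omega>" for k
    proof -
      obtain w where "set w \<subseteq> {..Suc k}" "word_event (Suc k) w t (waits \<omega>)" "clock_path (waits \<omega>) (traj \<omega>)"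
        using elim(1) by blast
      then show ?thesis using clock_path.word_event_ordered[of "waits \<omega>" "traj \<omega>" "Suc k" w t k] by simp
    qed
    moreover from elim(2) obtain m where "X m t \<omega> < 0" "\<forall>k<m. \<not> X k t \<omega> < 0"
      using exists_least_iff[of "\<lambda>k. X k t \<omega> < 0"] by blast
    ultimately show ?case by (auto simp: not_less)
  qed
qed

end

section \<open>Differentiating the expectation\<close>

lemma (in prob_space) sums_expectation_fibre:
  fixes N :: "'a \<Rightarrow> nat" and V :: "'a \<Rightarrow> real"
  assumes N [measurable]: "N \<in> measurable M (count_space UNIV)" and V: "integrable M V"
  shows "(\<lambda>n. expectation (\<lambda>\<omega>. if N \<omega> = n then V \<omega> else 0)) sums expectation V"
proof -
  have [measurable]: "V \<in> borel_measurable M" using V by simp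
  have int: "integrable M (\<lambda>\<omega>. if N \<omega> = n then V \<omega> else 0)" for n
    by (rule Bochner_Integration.integrable_bound[OF V]) auto
  have "(\<lambda>K. expectation (\<lambda>\<omega>. \<Sum>n<K. if N \<omega> = n then V \<omega> else 0)) \<longlonglongrightarrow> expectation V"
  proof (rule integral_dominated_convergence[where w = "\<lambda>\<omega>. \<bar>V \<omega>\<bar>"])
    show "AE \<omega> in M. (\<lambda>K. \<Sum>n<K. if N \<omega> = n then V \<omega> else 0) \<longlonglongrightarrow> V \<omega>"
    proof (intro AE_I2)
      fix \<omega>
      have "\<forall>\<^sub>F K in sequentially. (\<Sum>n<K. if N \<omega> = n then V \<omega> else 0) = V \<omega>"
        using eventually_gt_at_top[of "N \<omega>"] by eventually_elim simp
      then show "(\<lambda>K. \<Sum>n<K. if N \<omega> = n then V \<omega> else 0) \<longlonglongrightarrow> V \<omega>" by (rule tendsto_eventually)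
    qed
  qed (use V in auto)
  then show ?thesis unfolding sums_def by (simp only: Bochner_Integration.integral_sum int)
qed

lemma (in prob_space) integrable_fibre:
  fixes N :: "'a \<Rightarrow> nat" and V :: "'a \<Rightarrow> real"
  assumes N [measurable]: "N \<in> measurable M (count_space UNIV)"
    and int: "\<And>n. integrable M (\<lambda>\<omega>. if N \<omega> = n then V \<omega> else 0)"
    and sm: "summable (\<lambda>n. expectation (\<lambda>\<omega>. \<bar>if N \<omega> = n then V \<omega> else 0\<bar>))"
  shows "integrable M V"
proof -
  have single: "(\<lambda>n. if N \<omega> = n then V \<omega> else 0) sums V \<omega>" for \<omega>
    using sums_single[of "N \<omega>" "\<lambda>_. V \<omega>"] by (simp add: eq_commute)
  have "integrable M (\<lambda>\<omega>. \<Sum>n. if N \<omega> = n then V \<omega> else 0)"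
  proof (rule integrable_suminf[OF int])
    show "AE \<omega> in M. summable (\<lambda>n. norm (if N \<omega> = n then V \<omega> else 0))"
    proof (intro AE_I2)
      fix \<omega>
      show "summable (\<lambda>n. norm (if N \<omega> = n then V \<omega> else 0))"
        by (rule summable_finite[of "{N \<omega>}"]) auto
    qed
  qed (use sm in simp)
  then show ?thesis using single by (simp add: sums_iff)
qed

context step_tasep
begin

text \<open>A power series rather than an expectation, which makes the derivatives available; it is
  identified with a probability for \<open>0 < t\<close> in
  \<open>expectation_crossing\<close>.\<close>

definition flux :: "nat \<Rightarrow> real \<Rightarrow> real" where
  "flux k t = mean (int k) (Suc k) (crossing k) t"

definition pass :: "nat \<Rightarrow> real \<Rightarrow> real" where
  "pass n t = (case n of 0 \<Rightarrow> 1 | Suc k \<Rightarrow> mean (int k) (Suc k) (passed k) t)"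

definition law :: "nat \<Rightarrow> real \<Rightarrow> real" where
  "law n t = pass n t - pass (Suc n) t"

definition influx :: "nat \<Rightarrow> real \<Rightarrow> real" where
  "influx n t = (case n of 0 \<Rightarrow> 0 | Suc k \<Rightarrow> flux k t)"

lemma expectation_crossing:
  assumes "0 < t"
  shows "integrable M (\<lambda>\<omega>. if X k t \<omega> = - 1 \<and> (\<forall>j. k = Suc j \<longrightarrow> X j t \<omega> \<noteq> 0) then 1 else 0 :: real)"
    and "expectation (\<lambda>\<omega>. if X k t \<omega> = - 1 \<and> (\<forall>j. k = Suc j \<longrightarrow> X j t \<omega> \<noteq> 0) then 1 else 0) = flux k t"
proof -
  let ?V = "\<lambda>\<omega>. if X k t \<omega> = - 1 \<and> (\<forall>j. k = Suc j \<longrightarrow> X j t \<omega> \<noteq> 0) then 1 else 0 :: real"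
  have [measurable]: "X j t \<in> measurable M (count_space UNIV)" for j
    using measurable_pos assms by simp
  have V: "?V \<in> borel_measurable M" by measurable
  have eq: "?V \<omega> = crossing k (capped (traj \<omega>) (int k) (Suc k) t)" for \<omega>
    by (cases k) (auto simp: crossing_def capped_def ahead_def min_def)
  note * = expectation_capped[OF assms _ bounded_by_crossing V eq]
  show "integrable M ?V" "expectation ?V = flux k t"
    using * by (simp_all add: flux_def)
qed

lemma expectation_pass:
  assumes "0 < t"
  shows "integrable M (\<lambda>\<omega>. if \<forall>k. n = Suc k \<longrightarrow> 0 \<le> X k t \<omega> then 1 else 0 :: real)"
    and "expectation (\<lambda>\<omega>. if \<forall>k. n = Suc k \<longrightarrow> 0 \<le> X k t \<omega> then 1 else 0) = pass n t"
proof -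
  let ?V = "\<lambda>\<omega>. if \<forall>k. n = Suc k \<longrightarrow> 0 \<le> X k t \<omega> then 1 else 0 :: real"
  have "integrable M ?V \<and> expectation ?V = pass n t"
  proof (cases n)
    case 0
    then show ?thesis by (simp add: pass_def prob_space)
  next
    case (Suc k)
    have [measurable]: "X j t \<in> measurable M (count_space UNIV)" for j
      using measurable_pos assms by simp
    have V: "?V \<in> borel_measurable M" by measurable
    have eq: "?V \<omega> = passed k (capped (traj \<omega>) (int k) (Suc k) t)" for \<omega>
      using Suc by (auto simp: passed_def capped_def)
    note * = expectation_capped[OF assms _ bounded_by_passed V eq]
    show ?thesis using * Suc by (simp add: pass_def)
  qed
  then show "integrable M ?V" "expectation ?V = pass n t" by auto
qed

lemma expectation_gap:
  fixes k :: nat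
  assumes "0 < t"
  defines "V \<equiv> \<lambda>\<omega>. if 0 \<le> X k t \<omega> then real (nat (- 1 - X (Suc k) t \<omega>)) else 0"
  shows "integrable M V" "real (Suc k) * expectation V = t * flux k t"
proof -
  have [measurable]: "X j t \<in> measurable M (count_space UNIV)" for j
    using measurable_pos assms by simp
  have V: "(\<lambda>\<omega>. - (real (Suc k) * V \<omega>)) \<in> borel_measurable M" unfolding V_def by measurable
  \<comment> \<open>Particle \<open>k\<close> is capped at \<open>0\<close>, which keeps its sign.
    Particle \<open>Suc k\<close> is capped at \<open>-1\<close>, where the gap is \<open>0\<close>,
    as it is by \<open>nat\<close> for all sites beyond.\<close>
  have eq: "- (real (Suc k) * V \<omega>) = bwd (Suc k) (passed k) (capped (traj \<omega>) (int k) (Suc k) t)" for \<omega>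
    unfolding bwd_passed by (auto simp: V_def capped_def min_def)
  have "\<bar>passed k y\<bar> \<le> 1" for y by (simp add: passed_def)
  from expectation_capped[OF assms(1) _ bounded_by_bwd[OF _ this] V eq]
  have *: "integrable M (\<lambda>\<omega>. - (real (Suc k) * V \<omega>))"
    "expectation (\<lambda>\<omega>. - (real (Suc k) * V \<omega>)) = - (t * flux k t)"
    by (simp_all add: mean_bwd_passed flux_def)
  show "integrable M V" using *(1) by simp
  show "real (Suc k) * expectation V = t * flux k t" using *(2) by simp
qed

lemma AE_N0:
  assumes "0 < t"
  shows "AE \<omega> in M. (\<forall>k. X (Suc k) t \<omega> < X k t \<omega>) \<and> X (N0 X t \<omega>) t \<omega> < 0
    \<and> (\<forall>k. k < N0 X t \<omega> \<longleftrightarrow> 0 \<le> X k t \<omega>)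
    \<and> gap_sum X t \<omega> = real (nat (- 1 - X (N0 X t \<omega>) t \<omega>))
    \<and> occupation X t (X (N0 X t \<omega>) t \<omega>) \<omega> = 1
    \<and> (\<forall>y. X (N0 X t \<omega>) t \<omega> < y \<and> y < 0 \<longrightarrow> occupation X t y \<omega> = 0)"
  using AE_configuration[OF assms]
proof eventually_elim
  case (elim \<omega>)
  then obtain m where dec: "\<And>k. X (Suc k) t \<omega> < X k t \<omega>"
    and m: "X m t \<omega> < 0" "\<And>k. k < m \<Longrightarrow> 0 \<le> X k t \<omega>" by blast
  note c = configuration[of X t \<omega> m, OF dec m]
  have "k < m" if "0 \<le> X k t \<omega>" for k
  proof (rule ccontr)
    assume "\<not> k < m"
    then have "X k t \<omega> \<le> X m t \<omega>"
      using lift_Suc_antimono_le[of "\<lambda>k. X k t \<omega>" m k] dec by (simp add: less_imp_le)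
    then show False using that m(1) by simp
  qed
  then show ?case using c dec m by auto
qed

lemma prob_N0:
  assumes "0 < t"
  shows "prob {\<omega> \<in> space M. N0 X t \<omega> = n} = law n t"
proof -
  note [measurable] = measurable_N0[OF less_imp_le[OF assms]]
  let ?V = "\<lambda>n \<omega>. if \<forall>k. n = Suc k \<longrightarrow> 0 \<le> X k t \<omega> then 1 else 0 :: real"
  have "prob {\<omega> \<in> space M. N0 X t \<omega> = n} = expectation (indicator {\<omega> \<in> space M. N0 X t \<omega> = n})"
    by simp
  also have "\<dots> = expectation (\<lambda>\<omega>. ?V n \<omega> - ?V (Suc n) \<omega>)"
  proof (rule integral_cong_AE)
    show "(\<lambda>\<omega>. ?V n \<omega> - ?V (Suc n) \<omega>) \<in> borel_measurable M"
      using expectation_pass(1)[OF assms, of n] expectation_pass(1)[OF assms, of "Suc n"]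
      by (intro borel_measurable_diff borel_measurable_integrable)
    show "AE \<omega> in M. indicator {\<omega> \<in> space M. N0 X t \<omega> = n} \<omega> = ?V n \<omega> - ?V (Suc n) \<omega>"
      using AE_N0[OF assms] AE_space
    proof eventually_elim
      case (elim \<omega>)
      then have *: "0 \<le> X k t \<omega> \<longleftrightarrow> k < N0 X t \<omega>" for k by blast
      show ?case using elim(2) by (cases n) (auto simp: * indicator_def)
    qed
  qed measurable
  also have "\<dots> = law n t"
    using expectation_pass[OF assms, of n] expectation_pass[OF assms, of "Suc n"]
    by (simp only: Bochner_Integration.integral_diff law_def)
  finally show ?thesis .
qed

lemma flux_nonneg: "0 < t \<Longrightarrow> 0 \<le> flux k t"
  unfolding expectation_crossing(2)[symmetric] by (intro Bochner_Integration.integral_nonneg) auto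

text \<open>If particle \<open>k\<close> is at \<open>-1\<close>, the one ahead is at a site
  \<open>>= 0\<close>, so exactly \<open>k\<close> particles have passed.\<close>

lemma flux_le_law:
  assumes "0 < t"
  shows "flux k t \<le> law k t"
proof -
  note [measurable] = measurable_N0[OF less_imp_le[OF assms]]
  have "flux k t \<le> expectation (indicator {\<omega> \<in> space M. N0 X t \<omega> = k})"
    unfolding expectation_crossing(2)[OF assms, symmetric]
  proof (rule integral_mono_AE[OF expectation_crossing(1)[OF assms]])
    show "integrable M (indicator {\<omega> \<in> space M. N0 X t \<omega> = k} :: 'w \<Rightarrow> real)"
      by (intro integrable_real_indicator) (auto simp: emeasure_eq_measure)
    show "AE \<omega> in M. (if X k t \<omega> = - 1 \<and> (\<forall>j. k = Suc j \<longrightarrow> X j t \<omega> \<noteq> 0) then 1 else 0)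
        \<le> (indicator {\<omega> \<in> space M. N0 X t \<omega> = k} \<omega> :: real)"
      using AE_N0[OF assms] AE_space
    proof eventually_elim
      case (elim \<omega>)
      then have *: "0 \<le> X j t \<omega> \<longleftrightarrow> j < N0 X t \<omega>" for j by blast
      have "N0 X t \<omega> = k" if "X k t \<omega> = - 1" "\<forall>j. k = Suc j \<longrightarrow> X j t \<omega> \<noteq> 0"
      proof (cases k)
        case 0
        then show ?thesis using *[of 0] that by simp
      next
        case (Suc j)
        then have "X k t \<omega> < X j t \<omega>" using elim(1) by simp
        then show ?thesis using *[of j] *[of k] that Suc by simp
      qed
      then show ?case using elim(2) by (auto simp: indicator_def)
    qed
  qed
  then show ?thesis using prob_N0[OF assms, of k] by simp
qed

lemma law_nonneg: "0 < t \<Longrightarrow> 0 \<le> law k t"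
  using flux_nonneg flux_le_law order_trans by blast

lemma pass_DERIV: "(pass n has_real_derivative influx n t) (at t)"
proof (cases n)
  case 0
  then have "pass n = (\<lambda>_. 1)" by (simp add: pass_def fun_eq_iff)
  then show ?thesis using 0 by (simp add: influx_def)
next
  case (Suc k)
  then have "pass n = mean (int k) (Suc k) (passed k)" by (simp add: pass_def fun_eq_iff)
  then show ?thesis using Suc mean_passed_DERIV[of k t] by (simp add: influx_def flux_def)
qed

lemma law_DERIV: "(law n has_real_derivative influx n t - flux n t) (at t)"
  unfolding law_def[abs_def] using DERIV_diff[OF pass_DERIV[of n] pass_DERIV[of "Suc n"]]
  by (simp add: influx_def)

lemma flux_DERIV: "0 \<le> t \<Longrightarrow> \<exists>D. (flux k has_real_derivative D) (at t) \<and> - flux k t \<le> D"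
  unfolding flux_def[abs_def] by (rule mean_crossing_DERIV)

lemma influx_nonneg: "0 < t \<Longrightarrow> 0 \<le> influx n t"
  by (cases n) (auto simp: influx_def flux_nonneg)

text \<open>The next two estimates dominate the law near \<open>t\<close> by the law at one later time; this gives the
  uniform convergence needed to differentiate the series termwise.\<close>

lemma law_le_later:
  assumes "0 < s" "s \<le> T"
  shows "law n s \<le> exp (T - s) * law n T"
proof -
  \<comment> \<open>The outflow from \<open>n\<close> is at most \<open>law n\<close>, so the factor
    \<open>exp\<close> makes the function nondecreasing.\<close>
  have "exp s * law n s \<le> exp T * law n T"
  proof (rule DERIV_nonneg_imp_nondecreasing[OF assms(2)])
    fix r assume r: "s \<le> r" "r \<le> T"
    have "((\<lambda>r. exp r * law n r) has_real_derivative exp r * law n r + (influx n r - flux n r) * exp r) (at r)"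
      by (intro DERIV_mult DERIV_exp law_DERIV)
    moreover have "0 \<le> exp r * (law n r + influx n r - flux n r)"
      using flux_le_law[of r n] influx_nonneg[of r n] r assms by simp
    ultimately show "\<exists>D. ((\<lambda>r. exp r * law n r) has_real_derivative D) (at r) \<and> 0 \<le> D"
      by (auto simp: algebra_simps)
  qed
  then show ?thesis by (simp add: exp_diff field_simps)
qed

lemma flux_le_later:
  assumes "0 < s" "s < T"
  shows "flux n s \<le> exp (T - s) / (T - s) * law (Suc n) T"
proof -
  have mono: "exp s * flux n s \<le> exp r * flux n r" if "s \<le> r" for r
  proof (rule DERIV_nonneg_imp_nondecreasing[OF that])
    fix q assume q: "s \<le> q" "q \<le> r"
    obtain D where D: "(flux n has_real_derivative D) (at q)" "- flux n q \<le> D"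
      using flux_DERIV[of q n] q assms by auto
    have "((\<lambda>r. exp r * flux n r) has_real_derivative exp q * flux n q + D * exp q) (at q)"
      by (intro DERIV_mult DERIV_exp D)
    moreover have "0 \<le> exp q * (flux n q + D)" using D(2) by simp
    ultimately show "\<exists>D. ((\<lambda>r. exp r * flux n r) has_real_derivative D) (at q) \<and> 0 \<le> D"
      by (auto simp: algebra_simps)
  qed
  let ?c = "exp s * flux n s" and ?p = "law (Suc n)"
  \<comment> \<open>By \<open>mono\<close> the inflow into \<open>Suc n\<close>, multiplied by
    \<open>exp r\<close>, is at least \<open>?c\<close> throughout, so \<open>exp r * ?p r\<close>
    grows by at least \<open>?c * (T - s)\<close>.\<close>
  have "exp s * ?p s - ?c * s \<le> exp T * ?p T - ?c * T"
  proof (rule DERIV_nonneg_imp_nondecreasing[OF less_imp_le[OF assms(2)]])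
    fix r assume r: "s \<le> r" "r \<le> T"
    have "((\<lambda>r. exp r * ?p r - ?c * r) has_real_derivative
        (exp r * ?p r + (influx (Suc n) r - flux (Suc n) r) * exp r) - ?c * 1) (at r)"
      by (intro DERIV_diff DERIV_mult DERIV_exp law_DERIV DERIV_cmult DERIV_ident)
    moreover have "0 \<le> exp r * (?p r - flux (Suc n) r)"
      using flux_le_law[of r "Suc n"] r assms by simp
    then have "0 \<le> exp r * (?p r - flux (Suc n) r) + (exp r * flux n r - ?c)"
      using mono[OF r(1)] by linarith
    then have "0 \<le> (exp r * ?p r + (influx (Suc n) r - flux (Suc n) r) * exp r) - ?c * 1"
      by (simp add: influx_def algebra_simps)
    ultimately show "\<exists>D. ((\<lambda>r. exp r * ?p r - ?c * r) has_real_derivative D) (at r) \<and> 0 \<le> D" by blast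
  qed
  moreover have "0 \<le> exp s * ?p s" using law_nonneg[OF assms(1)] by simp
  ultimately have "?c * (T - s) \<le> exp T * ?p T" by (simp add: algebra_simps)
  then show ?thesis using assms by (simp add: exp_diff field_simps)
qed

section \<open>Termwise differentiation\<close>

lemma expectation_N0_sums:
  assumes "0 < t" and int: "integrable M (\<lambda>\<omega>. G (N0 X t \<omega>))"
  shows "(\<lambda>n. G n * law n t) sums expectation (\<lambda>\<omega>. G (N0 X t \<omega>))"
proof -
  note N0 = measurable_N0[OF less_imp_le[OF assms(1)]]
  note [measurable] = N0
  have "expectation (\<lambda>\<omega>. if N0 X t \<omega> = n then G (N0 X t \<omega>) else 0) = G n * law n t" for n
  proof -
    have "expectation (\<lambda>\<omega>. if N0 X t \<omega> = n then G (N0 X t \<omega>) else 0)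
        = expectation (\<lambda>\<omega>. G n * indicator {\<omega> \<in> space M. N0 X t \<omega> = n} \<omega>)"
      by (intro Bochner_Integration.integral_cong) (auto simp: indicator_def)
    then show ?thesis using prob_N0[OF assms(1), of n] by simp
  qed
  with sums_expectation_fibre[OF N0 int] show ?thesis by simp
qed

lemma measurable_rhs_integrand:
  assumes "0 \<le> t"
  shows "rhs_integrand G X t \<in> borel_measurable M"
proof -
  have [measurable]: "(\<lambda>\<omega>. g (N0 X t \<omega>)) \<in> borel_measurable M" for g :: "nat \<Rightarrow> real"
    by (rule measurable_compose[OF measurable_N0[OF assms]]) simp
  have [measurable]: "gap_sum X t \<in> borel_measurable M" by (rule measurable_gap_sum[OF assms])
  show ?thesis unfolding rhs_integrand_def[abs_def] by measurable
qed

text \<open>The two choices of \<open>g\<close> serve absolute summability and the value of the sum,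
  with the same computation.\<close>

lemma rhs_integrand_fibre:
  fixes g :: "real \<Rightarrow> real" and G :: "nat \<Rightarrow> real"
  assumes t: "0 < t" and g: "g = abs \<or> g = (\<lambda>x. x)"
  defines "F \<equiv> \<lambda>n \<omega>. if N0 X t \<omega> = n then rhs_integrand G X t \<omega> else 0"
  shows "integrable M (F 0)" "expectation (\<lambda>\<omega>. g (F 0 \<omega>)) = 0"
    and "integrable M (F (Suc n))" "expectation (\<lambda>\<omega>. g (F (Suc n) \<omega>)) = t * (g (G n - G (Suc n)) * flux n t)"
proof -
  have "F 0 = (\<lambda>_. 0)" by (auto simp: F_def rhs_integrand_def fun_eq_iff)
  moreover have "g 0 = 0" using g by auto
  ultimately show "integrable M (F 0)" "expectation (\<lambda>\<omega>. g (F 0 \<omega>)) = 0" by auto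
  let ?V = "\<lambda>\<omega>. if 0 \<le> X n t \<omega> then real (nat (- 1 - X (Suc n) t \<omega>)) else 0"
  let ?c = "real (Suc n) * (G n - G (Suc n))"
  note [measurable] = measurable_N0[OF less_imp_le[OF t]] measurable_rhs_integrand[OF less_imp_le[OF t]]
  have mF: "F (Suc n) \<in> borel_measurable M" unfolding F_def by measurable
  have eq: "AE \<omega> in M. F (Suc n) \<omega> = ?c * ?V \<omega>"
    using AE_N0[OF t]
  proof eventually_elim
    case (elim \<omega>)
    then have *: "0 \<le> X j t \<omega> \<longleftrightarrow> j < N0 X t \<omega>" for j by blast
    show ?case
    proof (cases "N0 X t \<omega> = Suc n")
      case True
      then show ?thesis using elim *[of n] by (simp add: F_def rhs_integrand_def)
    next
      case False
      then have "?V \<omega> = 0" using *[of n] *[of "Suc n"] by auto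
      then show ?thesis using False by (simp add: F_def)
    qed
  qed
  have iV: "integrable M (\<lambda>\<omega>. ?c * ?V \<omega>)"
    by (intro integrable_mult_right expectation_gap(1)[OF t])
  then show "integrable M (F (Suc n))"
    by (rule integrable_cong_AE_imp[OF _ mF]) (use eq in eventually_elim, simp)
  have gm: "g \<in> borel_measurable borel" using g by auto
  have "expectation (\<lambda>\<omega>. g (F (Suc n) \<omega>)) = expectation (\<lambda>\<omega>. real (Suc n) * g (G n - G (Suc n)) * ?V \<omega>)"
  proof (rule integral_cong_AE)
    show "(\<lambda>\<omega>. g (F (Suc n) \<omega>)) \<in> borel_measurable M" by (rule measurable_compose[OF mF gm])
    show "(\<lambda>\<omega>. real (Suc n) * g (G n - G (Suc n)) * ?V \<omega>) \<in> borel_measurable M"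
      by (intro borel_measurable_integrable integrable_mult_right expectation_gap(1)[OF t])
    show "AE \<omega> in M. g (F (Suc n) \<omega>) = real (Suc n) * g (G n - G (Suc n)) * ?V \<omega>"
      using eq by eventually_elim (use g in \<open>auto simp: abs_mult\<close>)
  qed
  also have "\<dots> = g (G n - G (Suc n)) * (real (Suc n) * expectation ?V)"
    by simp
  also have "\<dots> = t * (g (G n - G (Suc n)) * flux n t)"
    unfolding expectation_gap(2)[OF t] by simp
  finally show "expectation (\<lambda>\<omega>. g (F (Suc n) \<omega>)) = t * (g (G n - G (Suc n)) * flux n t)" .
qed

lemma expectation_rhs_integrand:
  assumes t: "0 < t" and sm: "summable (\<lambda>n. \<bar>G n - G (Suc n)\<bar> * flux n t)"
  shows "integrable M (rhs_integrand G X t)"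
    and "expectation (rhs_integrand G X t) = t * (\<Sum>n. (G n - G (Suc n)) * flux n t)"
proof -
  let ?F = "\<lambda>n \<omega>. if N0 X t \<omega> = n then rhs_integrand G X t \<omega> else 0"
  note N0 = measurable_N0[OF less_imp_le[OF t]]
  have int: "integrable M (?F n)" for n
    using rhs_integrand_fibre(1,3)[OF t disjI2[OF refl]] by (cases n) auto
  have "summable (\<lambda>n. expectation (\<lambda>\<omega>. \<bar>?F (Suc n) \<omega>\<bar>))"
    unfolding rhs_integrand_fibre(4)[OF t disjI1[OF refl]] by (rule summable_mult[OF sm])
  then have "summable (\<lambda>n. expectation (\<lambda>\<omega>. \<bar>?F n \<omega>\<bar>))"
    by (subst (asm) summable_Suc_iff)
  with int show *: "integrable M (rhs_integrand G X t)" by (rule integrable_fibre[OF N0])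
  have "(\<lambda>n. expectation (?F n)) sums expectation (rhs_integrand G X t)"
    by (rule sums_expectation_fibre[OF N0 *])
  moreover have "expectation (?F 0) = 0" using rhs_integrand_fibre(2)[OF t disjI2[OF refl]] .
  ultimately have "(\<lambda>n. expectation (?F (Suc n))) sums expectation (rhs_integrand G X t)"
    by (subst sums_Suc_iff) simp
  then have "(\<lambda>n. t * ((G n - G (Suc n)) * flux n t)) sums expectation (rhs_integrand G X t)"
    unfolding rhs_integrand_fibre(4)[OF t disjI2[OF refl]] .
  from sums_mult_D[OF this] t show "expectation (rhs_integrand G X t) = t * (\<Sum>n. (G n - G (Suc n)) * flux n t)"
    by (simp add: sums_iff)
qed

lemma expectation_N0_DERIV:
  assumes t: "0 < t" and ev: "\<forall>\<^sub>F s in nhds t. integrable M (\<lambda>\<omega>. G (N0 X s \<omega>))"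
  shows "summable (\<lambda>n. \<bar>G n - G (Suc n)\<bar> * flux n t)"
    and "((\<lambda>s. expectation (\<lambda>\<omega>. G (N0 X s \<omega>))) has_real_derivative
          - (\<Sum>n. (G n - G (Suc n)) * flux n t)) (at t)"
proof -
  obtain d where d: "0 < d" "\<And>s. dist s t < d \<Longrightarrow> integrable M (\<lambda>\<omega>. G (N0 X s \<omega>))"
    using ev unfolding eventually_nhds_metric by blast
  \<comment> \<open>\<open>T\<close> stays inside the range of integrability, while every
    \<open>s\<close> in \<open>S\<close> keeps distance at least \<open>h\<close> from
    \<open>T\<close>, so the factor \<open>1 / (T - s)\<close> in \<open>flux_le_later\<close> is
    bounded. The bound \<open>t / 2\<close> keeps \<open>S\<close> positive.\<close>
  define T where "T = t + d / 2"
  define h where "h = d / 4"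
  define S where "S = {max (t / 2) (t - h)<..<t + h}"
  have h: "0 < h" using d(1) by (simp add: h_def)
  have T: "0 < T" "integrable M (\<lambda>\<omega>. G (N0 X T \<omega>))"
    using t d by (auto simp: T_def dist_real_def)
  have S: "0 < s" "s < T" "h \<le> T - s" "T - s \<le> T" "dist s t < d" if "s \<in> S" for s
    using that t d(1) by (auto simp: S_def T_def h_def dist_real_def)
  have tS: "t \<in> S" using t h by (auto simp: S_def)
  have opS: "open S" by (simp add: S_def)
  define q where "q n = \<bar>G n\<bar> * law n T" for n
  have "(\<lambda>n. \<bar>G n\<bar> * law n T) sums expectation (\<lambda>\<omega>. \<bar>G (N0 X T \<omega>)\<bar>)"
    by (rule expectation_N0_sums[OF T(1), of "\<lambda>n. \<bar>G n\<bar>"]) (use T(2) in simp)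
  then have sq: "summable q" unfolding q_def by (rule sums_summable)
  then have sq': "summable (\<lambda>n. q (Suc n))" by (subst summable_Suc_iff)
  define c where "c = exp T / h"
  have law_le: "\<bar>G n\<bar> * law n s \<le> exp T * q n" if "s \<in> S" for n s
  proof -
    have "law n s \<le> exp (T - s) * law n T" using S[OF that] by (intro law_le_later) auto
    also have "\<dots> \<le> exp T * law n T" using S[OF that] T law_nonneg by (intro mult_right_mono) auto
    finally have "\<bar>G n\<bar> * law n s \<le> \<bar>G n\<bar> * (exp T * law n T)" by (rule mult_left_mono) simp
    then show ?thesis unfolding q_def by (simp only: mult.left_commute)
  qed
  have flux_le: "flux n s \<le> c * law (Suc n) T" if "s \<in> S" for n s
  proof -
    have "flux n s \<le> exp (T - s) / (T - s) * law (Suc n) T" using S[OF that] by (intro flux_le_later) auto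
    also have "\<dots> \<le> c * law (Suc n) T"
      unfolding c_def using S[OF that] T h law_nonneg by (intro mult_right_mono frac_le) auto
    finally show ?thesis .
  qed
  have infl_le: "\<bar>G n\<bar> * influx n s \<le> c * q n" if "s \<in> S" for n s
  proof (cases n)
    case 0
    then show ?thesis using h law_nonneg[OF T(1)] by (simp add: influx_def q_def c_def)
  next
    case (Suc k)
    then show ?thesis using mult_left_mono[OF flux_le[OF that, of k], of "\<bar>G n\<bar>"]
      by (simp add: influx_def q_def mult.left_commute)
  qed
  have Gflux_le: "\<bar>G n\<bar> * flux n s \<le> exp T * q n" if "s \<in> S" for n s
    using law_le[OF that, of n] mult_left_mono[OF flux_le_law[OF S(1)[OF that], of n], of "\<bar>G n\<bar>"] by simp
  have s1: "summable (\<lambda>n. \<bar>G n * flux n t\<bar>)"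
    by (rule summable_comparison_test'[OF summable_mult[OF sq, of "exp T"]])
      (use Gflux_le[OF tS] flux_nonneg[OF t] in \<open>simp add: abs_mult\<close>)
  have s2: "summable (\<lambda>n. \<bar>G (Suc n) * flux n t\<bar>)"
    by (rule summable_comparison_test'[OF summable_mult[OF sq', of c]])
      (use infl_le[OF tS, of "Suc _"] flux_nonneg[OF t] in \<open>simp add: abs_mult influx_def\<close>)
  show "summable (\<lambda>n. \<bar>G n - G (Suc n)\<bar> * flux n t)"
  proof (rule summable_comparison_test'[OF summable_add[OF s1 s2]])
    fix n :: nat
    have "\<bar>G n - G (Suc n)\<bar> * flux n t \<le> (\<bar>G n\<bar> + \<bar>G (Suc n)\<bar>) * flux n t"
      using flux_nonneg[OF t] by (intro mult_right_mono) auto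
    then show "norm (\<bar>G n - G (Suc n)\<bar> * flux n t) \<le> \<bar>G n * flux n t\<bar> + \<bar>G (Suc n) * flux n t\<bar>"
      using flux_nonneg[OF t, of n] by (simp add: abs_mult distrib_right)
  qed
  let ?f' = "\<lambda>n s. G n * (influx n s - flux n s)"
  have series: "((\<lambda>s. \<Sum>n. G n * law n s) has_real_derivative (\<Sum>n. ?f' n t)) (at t)"
  proof (rule has_field_derivative_series'(2)[where S = S and x0 = t])
    show "convex S" by (simp add: S_def)
    show "((\<lambda>s. G n * law n s) has_real_derivative ?f' n s) (at s within S)" for n s
      using DERIV_cmult[OF law_DERIV] has_field_derivative_at_within by blast
    show "uniformly_convergent_on S (\<lambda>n s. \<Sum>i<n. ?f' i s)"
    proof (rule Weierstrass_m_test'[where M = "\<lambda>n. c * q n + exp T * q n"])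
      fix n s assume s: "s \<in> S"
      have "\<bar>influx n s - flux n s\<bar> \<le> influx n s + flux n s"
        using influx_nonneg[OF S(1)[OF s], of n] flux_nonneg[OF S(1)[OF s], of n] by linarith
      then have "\<bar>?f' n s\<bar> \<le> \<bar>G n\<bar> * (influx n s + flux n s)"
        by (simp add: abs_mult mult_left_mono)
      then show "norm (?f' n s) \<le> c * q n + exp T * q n"
        using infl_le[OF s, of n] Gflux_le[OF s, of n] by (simp add: distrib_left)
    qed (intro summable_add summable_mult sq)
    show "t \<in> interior S" using tS opS by (simp add: interior_open)
    show "summable (\<lambda>n. G n * law n t)"
      by (rule sums_summable[OF expectation_N0_sums[OF t d(2)]]) (use d in simp)
  qed (rule tS)
  have ev': "\<forall>\<^sub>F s in nhds t. expectation (\<lambda>\<omega>. G (N0 X s \<omega>)) = (\<Sum>n. G n * law n s)"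
    using eventually_nhds_in_open[OF opS tS]
  proof eventually_elim
    case (elim s)
    show ?case using sums_unique[OF expectation_N0_sums[OF S(1)[OF elim] d(2)[OF S(5)[OF elim]]]] .
  qed
  \<comment> \<open>Summation by parts; the index shift is free because \<open>influx 0\<close> is
    zero.\<close>
  have "(\<Sum>n. ?f' n t) = - (\<Sum>n. (G n - G (Suc n)) * flux n t)"
  proof -
    note r1 = summable_rabs_cancel[OF s1] and r2 = summable_rabs_cancel[OF s2]
    have "(\<lambda>n. G (Suc n) * influx (Suc n) t) sums (\<Sum>n. G (Suc n) * flux n t)"
      using summable_sums[OF r2] by (simp add: influx_def)
    then have "(\<lambda>n. G n * influx n t) sums (\<Sum>n. G (Suc n) * flux n t)"
      by (subst (asm) sums_Suc_iff) (simp add: influx_def)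
    from sums_diff[OF this summable_sums[OF r1]]
    have "(\<Sum>n. ?f' n t) = (\<Sum>n. G (Suc n) * flux n t) - (\<Sum>n. G n * flux n t)"
      by (simp add: sums_iff right_diff_distrib)
    also have "\<dots> = - (\<Sum>n. (G n - G (Suc n)) * flux n t)"
      using suminf_diff[OF r1 r2] by (simp add: left_diff_distrib)
    finally show ?thesis .
  qed
  then show "((\<lambda>s. expectation (\<lambda>\<omega>. G (N0 X s \<omega>))) has_real_derivative
      - (\<Sum>n. (G n - G (Suc n)) * flux n t)) (at t)"
    using series DERIV_cong_ev[OF refl ev' refl] by simp
qed

end

theorem corollary7p3:
  fixes M :: "'w measure"
    and W :: "nat \<Rightarrow> nat \<Rightarrow> 'w \<Rightarrow> real"
    and X :: "nat \<Rightarrow> real \<Rightarrow> 'w \<Rightarrow> int"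
    and G :: "nat \<Rightarrow> real"
    and t :: real
  assumes "tasep M step_init W X"
    and "t > 0"
    and "\<forall>\<^sub>F s in nhds t. integrable M (\<lambda>\<omega>. G (N0 X s \<omega>))"
  shows "integrable M (rhs_integrand G X t)
    \<and> ((\<lambda>s. integral\<^sup>L M (\<lambda>\<omega>. G (N0 X s \<omega>))) has_real_derivative
          - (1 / t) * integral\<^sup>L M (rhs_integrand G X t)) (at t)
    \<and> (AE \<omega> in M.
          (\<forall>x\<ge>1. \<forall>y\<ge>1. gap_term X t x \<omega> \<noteq> 0 \<and> gap_term X t y \<omega> \<noteq> 0 \<longrightarrow> x = y)
        \<and> (\<exists>r<0. occupation X t r \<omega> = 1 \<and> (\<forall>y. r < y \<and> y < 0 \<longrightarrow> occupation X t y \<omega> = 0)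
               \<and> gap_sum X t \<omega> = real (card {y. r < y \<and> y < 0})))"
proof (intro conjI)
  interpret step_tasep M W X
    using assms(1) by (simp add: step_tasep_def)
  note deriv = expectation_N0_DERIV[OF assms(2,3)]
  note rhs = expectation_rhs_integrand[OF assms(2) deriv(1)]
  show "integrable M (rhs_integrand G X t)" by (rule rhs)
  show "((\<lambda>s. integral\<^sup>L M (\<lambda>\<omega>. G (N0 X s \<omega>))) has_real_derivative
      - (1 / t) * integral\<^sup>L M (rhs_integrand G X t)) (at t)"
    using deriv(2) assms(2) by (simp add: rhs(2))
  show "AE \<omega> in M.
      (\<forall>x\<ge>1. \<forall>y\<ge>1. gap_term X t x \<omega> \<noteq> 0 \<and> gap_term X t y \<omega> \<noteq> 0 \<longrightarrow> x = y)
      \<and> (\<exists>r<0. occupation X t r \<omega> = 1 \<and> (\<forall>y. r < y \<and> y < 0 \<longrightarrow> occupation X t y \<omega> = 0)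
             \<and> gap_sum X t \<omega> = real (card {y. r < y \<and> y < 0}))"
    using AE_N0[OF assms(2)]
  proof eventually_elim
    case (elim \<omega>)
    have "{y. r < y \<and> y < 0} = {r<..<0}" for r :: int by auto
    then have "real (nat (- 1 - r)) = real (card {y. r < y \<and> y < 0})" for r by simp
    then show ?case using elim gap_term_unique[of X t _ \<omega>] by metis
  qed
qed

end
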